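(* Let $d,T\ge 1$, let $m$ be an even positive integer, let $n\ge 1$, and let $\tau\ge1$. Let $\sigma:\mathbb{R}\to\mathbb{R}$ be twice differentiable with $|\sigma(u)|\le\sigma_0$, $|\sigma'(u)|\le\sigma_1$, $|\sigma''(u)|\le\sigma_2$ for all $u$, where $\bar\sigma=(\sigma_0,\sigma_1,\sigma_2)\in(0,\infty)^3$. Let $\bar\nu=(\bar\nu_c,\bar\nu_u,\bar\nu_w)\in(0,\infty)^3$ and $\rho=(\rho_c,\rho_u,\rho_w)\in(0,\infty)^3$ with $\rho\ge\bar\nu$ componentwise. Let $f^\star=\tilde f(\cdot;v)\in\mathcal{F}_{\bar\nu}$ for some $v\in\mathcal{V}_{\bar\nu}$, let $X^{(1)},\dots,X^{(n)}\in\mathcal{X}$ and $y^{(j)}=f^\star(X^{(j)})$. Run projected gradient descent $\varphi^{(s+1)}=\Pi_{\Omega_\rho}\big(\varphi^{(s)}-\eta\nabla_\varphi\widehat{\mathcal L}_n(\varphi^{(s)})\big)$, $s=0,1,\dots$, from the symmetric initialization $\varphi^{(0)}$ with step size $\eta=1/\sqrt{\tau}$. Let $\delta,\delta'\in(0,1)$. Then there is a constant $C>0$ depending only on $\bar\sigma,\bar\nu,\rho$ such that on the event $\mathcal{E}_{U,m}(\delta')\cap\mathcal{E}_{\mathrm{app}}(\delta)$, \[ \min_{0\le s<\tau}\widehat{\mathcal L}_n(\varphi^{(s)})\le C\Big[\frac{L_{1,m}(\delta')^4}{\sqrt\tau}+L_{1,m}(\delta')\Big(B_{\mathrm{app},m}(\delta)+B_{\mathrm{lin},m}(\delta')+\frac{L_{1,m}(\delta')+L_{2,m}(\delta')}{\sqrt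 m}\Big)\Big], \] and the average iterate $\bar\varphi^{(\tau)}=\frac1\tau\sum_{s=0}^{\tau-1}\varphi^{(s)}$ satisfies \[ \widehat{\mathcal L}_n(\bar\varphi^{(\tau)})\le C\Big[\frac{L_{1,m}(\delta')^4}{\sqrt\tau}+L_{1,m}(\delta')\Big(B_{\mathrm{app},m}(\delta)+B_{\mathrm{lin},m}(\delta')+\frac{L_{1,m}(\delta')+L_{2,m}(\delta')}{\sqrt m}\Big)+B_{\mathrm{lin},m}(\delta')^2\Big]. \]
   Context: Data: $\mathcal{X}=\{X=(X_1,\dots,X_T)\in\mathbb{R}^{d\times T}:\max_t\|X_t\|_2\le1\}$; for each $X\in\mathcal X$ a fixed query $q_X\in\mathbb{R}^d$ with $\|q_X\|_2\le1$. Softmax $\sigma_s:\mathbb{R}^T\to\Delta_T$, $(\sigma_s(z))_t=e^{z_t}/\sum_s e^{z_s}$, with Jacobian $J_s(z)=\operatorname{diag}(\sigma_s(z))-\sigma_s(z)\sigma_s(z)^\top$. For $W\in\mathbb{R}^{d\times d}$: $a(X;W)=X\sigma_s(X^\top Wq_X)$ and $M(X;W)=XJ_s(X^\top Wq_X)X^\top$. For $\theta=(U,\operatorname{vec}(W))$, $U\in\mathbb{R}^d$: $h(X;\theta)=\sigma(U^\top a(X;W))$. Model: $f(X;\varphi)=m^{-1/2}\sum_{i=1}^m c_ih(X;\theta_i)$, $\varphi=(\varphi_1,\dots,\varphi_m)$, $\varphi_i=(c_i,U_i,\operatorname{vec}(W_i))\in\mathbb{R}\times\mathbb{R}^d\times\mathbb{R}^{d^2}$.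 Loss $\widehat{\mathcal L}_n(\varphi)=\frac1n\sum_{j=1}^n(f(X^{(j)};\varphi)-y^{(j)})^2$. Symmetric initialization $\varphi^{(0)}$: for $i\le m/2$, independently, $W_i^{(0)}$ has i.i.d. $\mathcal N(0,1)$ entries, $U_i^{(0)}\sim\mathcal N(0,I_d)$, $c_i^{(0)}$ uniform on $\{-1,1\}$; and $W_{i+m/2}^{(0)}=W_i^{(0)}$, $U_{i+m/2}^{(0)}=U_i^{(0)}$, $c_{i+m/2}^{(0)}=-c_i^{(0)}$. $\Omega_\rho=\{\varphi:|c_i-c_i^{(0)}|\le\rho_c/\sqrt m,\ \|U_i-U_i^{(0)}\|_2\le\rho_u/\sqrt m,\ \|W_i-W_i^{(0)}\|_F\le\rho_w/\sqrt m\ \forall i\in[m]\}$; $\Pi_{\Omega_\rho}$ is Euclidean projection. $B_{U,m}(\delta')=\sqrt d+\sqrt{2\log(m/(2\delta'))}+\rho_u/\sqrt m$; $L_{1,m}(\delta')=\sigma_1\sqrt{1+B_{U,m}(\delta')^2}$; $L_{2,m}(\delta')=\sigma_2(1+B_{U,m}(\delta')^2)+8\sigma_1\sqrt{1+B_{U,m}(\delta')^2}$; $B_{\mathrm{lin},m}(\delta')=\frac1{\sqrt m}\big(L_{1,m}(\delta')\rho_c\sqrt{\rho_w^2+\rho_u^2}+L_{2,m}(\delta')(\rho_w^2+\rho_u^2)\big)$; $B_{\mathrm{app},m}(\delta)=2(\sigma_0\bar\nu_c+\sigma_1\bar\nu_u+\sigma_1\bar\nu_w)\sqrt{2\log(2n/\delta)/m}$.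 Event $\mathcal E_{U,m}(\delta')=\{\max_{i\in[m]}\|U_i^{(0)}\|_2\le\sqrt d+\sqrt{2\log(m/(2\delta'))}\}$. Function class: let $\varphi_0=(c,U,\operatorname{vec}(W))$ have the law of $\varphi_1^{(0)}$; set $\phi_c(X)=\sigma(U^\top a(X;W))$, $\phi_u(X)=\sigma'(U^\top a(X;W))a(X;W)$, $\phi_w(X)=\sigma'(U^\top a(X;W))(M(X;W)U)q_X^\top$. For measurable $v=(v_c,v_u,v_w):\mathbb{R}^{d^2+d+1}\to\mathbb{R}\times\mathbb{R}^d\times\mathbb{R}^{d\times d}$, $\tilde f(X;v)=\mathbb E[\phi_c(X)v_c(\varphi_0)]+\mathbb E[\langle\phi_u(X),v_u(\varphi_0)\rangle]+\mathbb E[\langle\phi_w(X),v_w(\varphi_0)\rangle_F]$. $\mathcal V_{\bar\nu}$ is the set of such $v$ with $\sup|v_c|\le\bar\nu_c$, $\sup\|v_u\|_2\le\bar\nu_u$, $\sup\|v_w\|_F\le\bar\nu_w$, and $\mathcal F_{\bar\nu}=\{\tilde f(\cdot;v):v\in\mathcal V_{\bar\nu}\}$. Linear model: $f_{\mathrm{lin}}(X;\varphi)=f(X;\varphi^{(0)})+\langle\nabla_\varphi f(X;\varphi^{(0)}),\varphi-\varphi^{(0)}\rangle$. Transported parameters $\tilde\varphi$: $\tilde c_i=c_i^{(0)}+m^{-1/2}v_c(\varphi_i^{(0)})$, $\tilde U_i=U_i^{(0)}+c_i^{(0)}m^{-1/2}v_u(\varphi_i^{(0)})$, $\tilde W_i=W_i^{(0)}+c_i^{(0)}m^{-1/2}v_w(\varphi_i^{(0)})$.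 Event $\mathcal E_{\mathrm{app}}(\delta)=\{\sup_{j\in[n]}|f_{\mathrm{lin}}(X^{(j)};\tilde\varphi)-\tilde f(X^{(j)};v)|\le B_{\mathrm{app},m}(\delta)\}$ (for the $v$ representing $f^\star$). *)

theory Defs
  imports "HOL-Probability.Probability"
begin

(* Single-neuron coordinates: c, U_k (k<d), W_{k,l} (k,l<d). *)
datatype ncoord = Nc | Nu nat | Nw nat nat

type_synonym mat = "nat \<Rightarrow> nat \<Rightarrow> real"
(* a full parameter phi: phi i kappa = coordinate kappa of neuron i *)
type_synonym param = "nat \<Rightarrow> ncoord \<Rightarrow> real"

definition ncoords :: "nat \<Rightarrow> ncoord set" where
  "ncoords d = {Nc} \<union> Nu ` {..<d} \<union> (\<lambda>(k,l). Nw k l) ` ({..<d} \<times> {..<d})"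

definition inX :: "nat \<Rightarrow> nat \<Rightarrow> mat \<Rightarrow> bool" where
  "inX d T X \<longleftrightarrow> (\<forall>t<T. sqrt (\<Sum>k<d. (X k t)^2) \<le> 1)"

definition softmax :: "nat \<Rightarrow> (nat \<Rightarrow> real) \<Rightarrow> nat \<Rightarrow> real" where
  "softmax T z t = exp (z t) / (\<Sum>s<T. exp (z s))"

definition softmax_jac :: "nat \<Rightarrow> (nat \<Rightarrow> real) \<Rightarrow> nat \<Rightarrow> nat \<Rightarrow> real" where
  "softmax_jac T z t t' =
     (if t = t' then softmax T z t else 0) - softmax T z t * softmax T z t'"

definition scores :: "nat \<Rightarrow> mat \<Rightarrow> mat \<Rightarrow> (nat \<Rightarrow> real) \<Rightarrow> nat \<Rightarrow> real" where
  "scores d X W qx t = (\<Sum>k<d. X k t * (\<Sum>l<d. W k l * qx l))"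

definition attn :: "nat \<Rightarrow> nat \<Rightarrow> (mat \<Rightarrow> nat \<Rightarrow> real) \<Rightarrow> mat \<Rightarrow> mat \<Rightarrow> nat \<Rightarrow> real" where
  "attn d T q X W k = (\<Sum>t<T. X k t * softmax T (scores d X W (q X)) t)"

definition Mmat :: "nat \<Rightarrow> nat \<Rightarrow> (mat \<Rightarrow> nat \<Rightarrow> real) \<Rightarrow> mat \<Rightarrow> mat \<Rightarrow> nat \<Rightarrow> nat \<Rightarrow> real" where
  "Mmat d T q X W k k' =
     (\<Sum>t<T. \<Sum>t'<T. X k t * softmax_jac T (scores d X W (q X)) t t' * X k' t')"

definition preact :: "nat \<Rightarrow> nat \<Rightarrow> (mat \<Rightarrow> nat \<Rightarrow> real) \<Rightarrow> mat \<Rightarrow> (nat \<Rightarrow> real) \<Rightarrow> mat \<Rightarrow> real" where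
  "preact d T q X U W = (\<Sum>k<d. U k * attn d T q X W k)"

definition nU :: "(ncoord \<Rightarrow> real) \<Rightarrow> nat \<Rightarrow> real" where
  "nU p k = p (Nu k)"

definition nW :: "(ncoord \<Rightarrow> real) \<Rightarrow> mat" where
  "nW p k l = p (Nw k l)"

definition hneur :: "(real \<Rightarrow> real) \<Rightarrow> nat \<Rightarrow> nat \<Rightarrow> (mat \<Rightarrow> nat \<Rightarrow> real) \<Rightarrow> mat \<Rightarrow> (ncoord \<Rightarrow> real) \<Rightarrow> real" where
  "hneur sg d T q X p = sg (preact d T q X (nU p) (nW p))"

definition fnet :: "(real \<Rightarrow> real) \<Rightarrow> nat \<Rightarrow> nat \<Rightarrow> nat \<Rightarrow> (mat \<Rightarrow> nat \<Rightarrow> real) \<Rightarrow> mat \<Rightarrow> param \<Rightarrow> real" where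
  "fnet sg d T m q X phi = (1 / sqrt (real m)) * (\<Sum>i<m. phi i Nc * hneur sg d T q X (phi i))"

definition loss :: "(real \<Rightarrow> real) \<Rightarrow> nat \<Rightarrow> nat \<Rightarrow> nat \<Rightarrow> (mat \<Rightarrow> nat \<Rightarrow> real) \<Rightarrow> nat
    \<Rightarrow> (nat \<Rightarrow> mat) \<Rightarrow> (nat \<Rightarrow> real) \<Rightarrow> param \<Rightarrow> real" where
  "loss sg d T m q n Xs ys phi = (1 / real n) * (\<Sum>j<n. (fnet sg d T m q (Xs j) phi - ys j)^2)"

definition ppartial :: "(param \<Rightarrow> real) \<Rightarrow> param \<Rightarrow> nat \<Rightarrow> ncoord \<Rightarrow> real" where
  "ppartial F phi i \<kappa> = deriv (\<lambda>t. F (phi(i := (phi i)(\<kappa> := phi i \<kappa> + t)))) 0"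

definition pgrad :: "nat \<Rightarrow> nat \<Rightarrow> (param \<Rightarrow> real) \<Rightarrow> param \<Rightarrow> param" where
  "pgrad m d F phi = (\<lambda>i \<kappa>. if i < m \<and> \<kappa> \<in> ncoords d then ppartial F phi i \<kappa> else 0)"

(* parameters living in R^{m(1+d+d^2)} (zero outside the coordinate set) *)
definition valid :: "nat \<Rightarrow> nat \<Rightarrow> param \<Rightarrow> bool" where
  "valid m d phi \<longleftrightarrow> (\<forall>i \<kappa>. \<not> (i < m \<and> \<kappa> \<in> ncoords d) \<longrightarrow> phi i \<kappa> = 0)"

definition pdist2 :: "nat \<Rightarrow> nat \<Rightarrow> param \<Rightarrow> param \<Rightarrow> real" where
  "pdist2 m d phi psi = (\<Sum>i<m. \<Sum>\<kappa>\<in>ncoords d. (phi i \<kappa> - psi i \<kappa>)^2)"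

definition proj :: "nat \<Rightarrow> nat \<Rightarrow> param set \<Rightarrow> param \<Rightarrow> param" where
  "proj m d S x = (SOME p. p \<in> S \<and> (\<forall>p'\<in>S. pdist2 m d p x \<le> pdist2 m d p' x))"

definition Omega :: "nat \<Rightarrow> nat \<Rightarrow> real \<Rightarrow> real \<Rightarrow> real \<Rightarrow> param \<Rightarrow> param set" where
  "Omega m d \<rho>c \<rho>u \<rho>w phi0 = {phi. valid m d phi \<and> (\<forall>i<m.
      \<bar>phi i Nc - phi0 i Nc\<bar> \<le> \<rho>c / sqrt (real m) \<and>
      sqrt (\<Sum>k<d. (phi i (Nu k) - phi0 i (Nu k))^2) \<le> \<rho>u / sqrt (real m) \<and>
      sqrt (\<Sum>k<d. \<Sum>l<d. (phi i (Nw k l) - phi0 i (Nw k l))^2) \<le> \<rho>w / sqrt (real m))}"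

(* a realization of the symmetric initialization *)
definition sym_init :: "nat \<Rightarrow> nat \<Rightarrow> param \<Rightarrow> bool" where
  "sym_init m d phi0 \<longleftrightarrow> valid m d phi0 \<and> even m \<and>
     (\<forall>i < m div 2. phi0 i Nc \<in> {-1, 1} \<and>
        phi0 (i + m div 2) Nc = - phi0 i Nc \<and>
        (\<forall>\<kappa>\<in>ncoords d. \<kappa> \<noteq> Nc \<longrightarrow> phi0 (i + m div 2) \<kappa> = phi0 i \<kappa>))"

definition rademacher :: "real measure" where
  "rademacher = distr (measure_pmf (pmf_of_set {-1, 1::real})) borel id"

definition law0 :: "nat \<Rightarrow> (ncoord \<Rightarrow> real) measure" where
  "law0 d = (\<Pi>\<^sub>M \<kappa>\<in>ncoords d. (if \<kappa> = Nc then rademacher else density lborel std_normal_density))"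

definition feat_c :: "(real \<Rightarrow> real) \<Rightarrow> nat \<Rightarrow> nat \<Rightarrow> (mat \<Rightarrow> nat \<Rightarrow> real) \<Rightarrow> mat \<Rightarrow> (ncoord \<Rightarrow> real) \<Rightarrow> real" where
  "feat_c sg d T q X p = sg (preact d T q X (nU p) (nW p))"

definition feat_u :: "(real \<Rightarrow> real) \<Rightarrow> nat \<Rightarrow> nat \<Rightarrow> (mat \<Rightarrow> nat \<Rightarrow> real) \<Rightarrow> mat \<Rightarrow> (ncoord \<Rightarrow> real) \<Rightarrow> nat \<Rightarrow> real" where
  "feat_u sg' d T q X p k = sg' (preact d T q X (nU p) (nW p)) * attn d T q X (nW p) k"

definition feat_w :: "(real \<Rightarrow> real) \<Rightarrow> nat \<Rightarrow> nat \<Rightarrow> (mat \<Rightarrow> nat \<Rightarrow> real) \<Rightarrow> mat \<Rightarrow> (ncoord \<Rightarrow> real) \<Rightarrow> nat \<Rightarrow> nat \<Rightarrow> real" where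
  "feat_w sg' d T q X p k l = sg' (preact d T q X (nU p) (nW p)) *
      (\<Sum>k'<d. Mmat d T q X (nW p) k k' * nU p k') * q X l"

definition ftilde :: "(real \<Rightarrow> real) \<Rightarrow> (real \<Rightarrow> real) \<Rightarrow> nat \<Rightarrow> nat \<Rightarrow> (mat \<Rightarrow> nat \<Rightarrow> real)
    \<Rightarrow> ((ncoord \<Rightarrow> real) \<Rightarrow> real) \<Rightarrow> ((ncoord \<Rightarrow> real) \<Rightarrow> nat \<Rightarrow> real) \<Rightarrow> ((ncoord \<Rightarrow> real) \<Rightarrow> mat)
    \<Rightarrow> mat \<Rightarrow> real" where
  "ftilde sg sg' d T q vc vu vw X =
     (\<integral>p. feat_c sg d T q X p * vc p \<partial>law0 d)
   + (\<integral>p. (\<Sum>k<d. feat_u sg' d T q X p k * vu p k) \<partial>law0 d)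
   + (\<integral>p. (\<Sum>k<d. \<Sum>l<d. feat_w sg' d T q X p k l * vw p k l) \<partial>law0 d)"

definition inV :: "nat \<Rightarrow> real \<Rightarrow> real \<Rightarrow> real \<Rightarrow> ((ncoord \<Rightarrow> real) \<Rightarrow> real)
    \<Rightarrow> ((ncoord \<Rightarrow> real) \<Rightarrow> nat \<Rightarrow> real) \<Rightarrow> ((ncoord \<Rightarrow> real) \<Rightarrow> mat) \<Rightarrow> bool" where
  "inV d \<nu>c \<nu>u \<nu>w vc vu vw \<longleftrightarrow>
     vc \<in> borel_measurable (law0 d) \<and>
     (\<forall>k<d. (\<lambda>p. vu p k) \<in> borel_measurable (law0 d)) \<and>
     (\<forall>k<d. \<forall>l<d. (\<lambda>p. vw p k l) \<in> borel_measurable (law0 d)) \<and>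
     (\<forall>p\<in>space (law0 d). \<bar>vc p\<bar> \<le> \<nu>c \<and>
        sqrt (\<Sum>k<d. (vu p k)^2) \<le> \<nu>u \<and>
        sqrt (\<Sum>k<d. \<Sum>l<d. (vw p k l)^2) \<le> \<nu>w)"

definition flin :: "(real \<Rightarrow> real) \<Rightarrow> nat \<Rightarrow> nat \<Rightarrow> nat \<Rightarrow> (mat \<Rightarrow> nat \<Rightarrow> real) \<Rightarrow> mat \<Rightarrow> param \<Rightarrow> param \<Rightarrow> real" where
  "flin sg d T m q X phi0 phi = fnet sg d T m q X phi0 +
     (\<Sum>i<m. \<Sum>\<kappa>\<in>ncoords d. ppartial (fnet sg d T m q X) phi0 i \<kappa> * (phi i \<kappa> - phi0 i \<kappa>))"

definition transported :: "nat \<Rightarrow> nat \<Rightarrow> ((ncoord \<Rightarrow> real) \<Rightarrow> real) \<Rightarrow> ((ncoord \<Rightarrow> real) \<Rightarrow> nat \<Rightarrow> real)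
    \<Rightarrow> ((ncoord \<Rightarrow> real) \<Rightarrow> mat) \<Rightarrow> param \<Rightarrow> param" where
  "transported m d vc vu vw phi0 = (\<lambda>i \<kappa>. if i < m \<and> \<kappa> \<in> ncoords d then
      (case \<kappa> of
         Nc \<Rightarrow> phi0 i Nc + vc (restrict (phi0 i) (ncoords d)) / sqrt (real m)
       | Nu k \<Rightarrow> phi0 i \<kappa> + phi0 i Nc * vu (restrict (phi0 i) (ncoords d)) k / sqrt (real m)
       | Nw k l \<Rightarrow> phi0 i \<kappa> + phi0 i Nc * vw (restrict (phi0 i) (ncoords d)) k l / sqrt (real m))
      else 0)"

definition B_U :: "nat \<Rightarrow> nat \<Rightarrow> real \<Rightarrow> real \<Rightarrow> real" where
  "B_U d m \<rho>u \<delta>' = sqrt (real d) + sqrt (2 * ln (real m / (2 * \<delta>'))) + \<rho>u / sqrt (real m)"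

definition L1 :: "real \<Rightarrow> nat \<Rightarrow> nat \<Rightarrow> real \<Rightarrow> real \<Rightarrow> real" where
  "L1 \<sigma>1 d m \<rho>u \<delta>' = \<sigma>1 * sqrt (1 + (B_U d m \<rho>u \<delta>')^2)"

definition L2 :: "real \<Rightarrow> real \<Rightarrow> nat \<Rightarrow> nat \<Rightarrow> real \<Rightarrow> real \<Rightarrow> real" where
  "L2 \<sigma>1 \<sigma>2 d m \<rho>u \<delta>' = \<sigma>2 * (1 + (B_U d m \<rho>u \<delta>')^2) + 8 * \<sigma>1 * sqrt (1 + (B_U d m \<rho>u \<delta>')^2)"

definition B_lin :: "real \<Rightarrow> real \<Rightarrow> nat \<Rightarrow> nat \<Rightarrow> real \<Rightarrow> real \<Rightarrow> real \<Rightarrow> real \<Rightarrow> real" where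
  "B_lin \<sigma>1 \<sigma>2 d m \<rho>c \<rho>u \<rho>w \<delta>' = (1 / sqrt (real m)) *
     (L1 \<sigma>1 d m \<rho>u \<delta>' * \<rho>c * sqrt (\<rho>w^2 + \<rho>u^2) + L2 \<sigma>1 \<sigma>2 d m \<rho>u \<delta>' * (\<rho>w^2 + \<rho>u^2))"

definition B_app :: "real \<Rightarrow> real \<Rightarrow> real \<Rightarrow> real \<Rightarrow> real \<Rightarrow> nat \<Rightarrow> nat \<Rightarrow> real \<Rightarrow> real" where
  "B_app \<sigma>0 \<sigma>1 \<nu>c \<nu>u \<nu>w n m \<delta> =
     2 * (\<sigma>0 * \<nu>c + \<sigma>1 * \<nu>u + \<sigma>1 * \<nu>w) * sqrt (2 * ln (2 * real n / \<delta>) / real m)"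

definition event_U :: "nat \<Rightarrow> nat \<Rightarrow> real \<Rightarrow> param \<Rightarrow> bool" where
  "event_U d m \<delta>' phi0 \<longleftrightarrow>
     (\<forall>i<m. sqrt (\<Sum>k<d. (phi0 i (Nu k))^2) \<le> sqrt (real d) + sqrt (2 * ln (real m / (2 * \<delta>'))))"

end

theory Submission
  imports Defs
begin

text \<open>
  The pre-activation of a neuron is a softmax average of the numbers \<open>U \<bullet> X\<^sub>t\<close>, so along a segment in
  parameter space its first two derivatives are softmax covariances, bounded by sup norms over the
  tokens independently of \<open>d\<close> and \<open>T\<close>. On \<open>\<Omega>\<^sub>\<rho>\<close> this makes the network Lipschitz with
  constant \<open>O(L\<^sub>1)\<close>, and by the \<open>1/\<surd>m\<close> scaling of the radii its linearization at any point of
  \<open>\<Omega>\<^sub>\<rho>\<close> is accurate up to \<open>O((L\<^sub>1 + L\<^sub>2)/\<surd>m)\<close>.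

  The transported parameters lie in \<open>\<Omega>\<^sub>\<rho>\<close> and fit the labels up to the approximation and
  linearization errors. Hence the inner product of the gradient with the displacement from the
  transported parameters dominates twice the loss, up to these errors times the residual bound
  \<open>O(L\<^sub>1)\<close>, and the usual telescoping of squared distances under the nonexpansive projection bounds
  the average of the losses. For the averaged iterate, the loss of the linearized model is convex.
\<close>


subsection \<open>Softmax averages and covariances\<close>

text \<open>The constant may depend on none of d, T, m, so every estimate has to end as a multiple
  of \<open>L\<^sub>1\<close> or \<open>L\<^sub>2\<close>. Absolute quantities are converted by
  \<open>\<sigma>1 \<le> L\<^sub>1\<close>, the dimension by
  \<open>\<sigma>1 * sqrt (real d) \<le> L\<^sub>1\<close>. Residual and network gradient are each
  O(\<open>L\<^sub>1\<close>), hence the loss gradient is O(\<open>L\<^sub>1\<^sup>2\<close>); its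
  square, weighted by the step size, is the source of
  \<open>L\<^sub>1 ^ 4 / sqrt (real \<tau>)\<close>. Two linearizations occur: the one at the
  initialization, in which the approximation event is phrased, and the one at the current iterate,
  which the gradient inequality needs. This is why the remainder is proved for an arbitrary base
  point of Omega. The gradient is defined coordinatewise through \<open>deriv\<close>, so it is
  reached from directional derivatives by linearity. The projection is a choice among minimizers, so
  its properties rest on compactness of Omega in the product topology.\<close>

definition smavg :: "nat \<Rightarrow> (nat \<Rightarrow> real) \<Rightarrow> (nat \<Rightarrow> real) \<Rightarrow> real" where
  "smavg T z u = (\<Sum>t<T. softmax T z t * u t)"

definition smcov :: "nat \<Rightarrow> (nat \<Rightarrow> real) \<Rightarrow> (nat \<Rightarrow> real) \<Rightarrow> (nat \<Rightarrow> real) \<Rightarrow> real" where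
  "smcov T z a b = smavg T z (\<lambda>t. a t * b t) - smavg T z a * smavg T z b"

lemma exp_sum_pos: "(T::nat) \<ge> 1 \<Longrightarrow> 0 < (\<Sum>s<T. exp (z s :: real))"
  by (intro sum_pos finite_lessThan) (auto simp: lessThan_empty_iff)

lemma softmax_nonneg: "0 \<le> softmax T z t"
  by (simp add: softmax_def sum_nonneg)

lemma sum_softmax: "T \<ge> 1 \<Longrightarrow> (\<Sum>t<T. softmax T z t) = 1"
  using exp_sum_pos[of T z] by (simp add: softmax_def flip: sum_divide_distrib)

lemma smavg_add: "smavg T z (\<lambda>t. a t + b t) = smavg T z a + smavg T z b"
  by (simp add: smavg_def sum.distrib algebra_simps)

lemma smavg_scale: "smavg T z (\<lambda>t. c * a t) = c * smavg T z a"
  by (simp add: smavg_def sum_distrib_left algebra_simps)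

lemma smcov_add_left: "smcov T z (\<lambda>t. a t + b t) u = smcov T z a u + smcov T z b u"
  by (simp add: smcov_def smavg_add algebra_simps)

lemma smcov_scale_left: "smcov T z (\<lambda>t. c * a t) u = c * smcov T z a u"
  by (simp add: smcov_def smavg_scale algebra_simps)

lemma abs_smavg_le:
  assumes "T \<ge> 1" "\<And>t. t < T \<Longrightarrow> \<bar>a t\<bar> \<le> A"
  shows "\<bar>smavg T z a\<bar> \<le> A"
proof -
  have "\<bar>smavg T z a\<bar> \<le> (\<Sum>t<T. \<bar>softmax T z t * a t\<bar>)"
    unfolding smavg_def by (rule sum_abs)
  also have "\<dots> \<le> (\<Sum>t<T. softmax T z t * A)"
    by (intro sum_mono) (auto simp: abs_mult softmax_nonneg intro!: mult_left_mono assms)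
  also have "\<dots> = A"
    using sum_softmax[OF assms(1), of z] by (simp flip: sum_distrib_right)
  finally show ?thesis .
qed

lemma abs_smcov_le:
  assumes "T \<ge> 1" "\<And>t. t < T \<Longrightarrow> \<bar>a t\<bar> \<le> A" "\<And>t. t < T \<Longrightarrow> \<bar>b t\<bar> \<le> B"
  shows "\<bar>smcov T z a b\<bar> \<le> 2 * A * B"
proof -
  have A: "\<bar>smavg T z a\<bar> \<le> A" "\<bar>smavg T z b\<bar> \<le> B"
    by (intro abs_smavg_le assms; assumption)+
  have "\<bar>smavg T z (\<lambda>t. a t * b t)\<bar> \<le> A * B"
    by (intro abs_smavg_le assms(1)) (auto simp: abs_mult intro!: mult_mono' assms)
  moreover have "\<bar>smavg T z a * smavg T z b\<bar> \<le> A * B"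
    unfolding abs_mult by (intro mult_mono' A) auto
  ultimately show ?thesis unfolding smcov_def by linarith
qed

text \<open>Quotient rule for N / Z: differentiating the softmax weights along
  \<open>\<zeta>\<close> produces a covariance with \<open>\<zeta>\<close>. The averaged values move
  as well, along \<open>\<omega>\<close>, so a single formula serves changes of W (through the
  scores) and of U (through the values).\<close>

lemma has_real_derivative_smavg:
  assumes T: "T \<ge> 1"
  shows "((\<lambda>s. smavg T (\<lambda>t. z t + s * \<zeta> t) (\<lambda>t. u t + s * \<omega> t)) has_real_derivative
     smavg T (\<lambda>t. z t + s * \<zeta> t) \<omega> + smcov T (\<lambda>t. z t + s * \<zeta> t) \<zeta> (\<lambda>t. u t + s * \<omega> t)) (at s)"
proof -
  define Z where "Z s = (\<Sum>t<T. exp (z t + s * \<zeta> t))" for s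
  define N where "N s = (\<Sum>t<T. exp (z t + s * \<zeta> t) * (u t + s * \<omega> t))" for s
  have Zpos: "Z s > 0" for s unfolding Z_def by (rule exp_sum_pos[OF T])
  have avg: "smavg T (\<lambda>t. z t + s * \<zeta> t) a = (\<Sum>t<T. exp (z t + s * \<zeta> t) * a t) / Z s" for s a
    by (simp add: smavg_def softmax_def Z_def sum_divide_distrib)
  have dZ: "(Z has_real_derivative (\<Sum>t<T. exp (z t + s * \<zeta> t) * \<zeta> t)) (at s)"
    unfolding Z_def by (auto intro!: derivative_eq_intros)
  have dN: "(N has_real_derivative (\<Sum>t<T. exp (z t + s * \<zeta> t) * \<omega> t
              + exp (z t + s * \<zeta> t) * (\<zeta> t * (u t + s * \<omega> t)))) (at s)"
    unfolding N_def by (auto intro!: derivative_eq_intros sum.cong simp: algebra_simps)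
  have "((\<lambda>s. N s / Z s) has_real_derivative
      ((\<Sum>t<T. exp (z t + s * \<zeta> t) * \<omega> t + exp (z t + s * \<zeta> t) * (\<zeta> t * (u t + s * \<omega> t))) * Z s
        - N s * (\<Sum>t<T. exp (z t + s * \<zeta> t) * \<zeta> t)) / (Z s * Z s)) (at s)"
    using Zpos[of s] by (intro DERIV_divide dN dZ) auto
  then show ?thesis
    unfolding avg smcov_def N_def[symmetric] sum.distrib
    using Zpos[of s] by (simp add: field_simps)
qed

section \<open>Mean value remainders for one neuron along a segment\<close>

lemma second_order_remainder:
  fixes f f' f'' :: "real \<Rightarrow> real"
  assumes f: "\<And>s. (f has_real_derivative f' s) (at s)"
    and f': "\<And>s. (f' has_real_derivative f'' s) (at s)"
    and K: "\<And>s. 0 \<le> s \<Longrightarrow> s \<le> 1 \<Longrightarrow> \<bar>f'' s\<bar> \<le> K"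
  shows "\<bar>f 1 - f 0 - f' 0\<bar> \<le> K"
proof -
  \<comment> \<open>The mean value theorem is applied to f and then to f' on the shorter interval;
    the factor \<open>\<xi> < 1\<close> is simply dropped. The resulting K, instead of the sharper
    K/2, is sufficient.\<close>
  obtain \<xi> where \<xi>: "0 < \<xi>" "\<xi> < 1" "f 1 - f 0 = f' \<xi>"
    using MVT2[of 0 1 f f'] f by auto
  obtain \<zeta> where \<zeta>: "0 < \<zeta>" "\<zeta> < \<xi>" "f' \<xi> - f' 0 = \<xi> * f'' \<zeta>"
    using MVT2[of 0 \<xi> f' f''] f' \<xi> by auto
  have "\<bar>\<xi> * f'' \<zeta>\<bar> \<le> 1 * K"
    unfolding abs_mult using \<xi> \<zeta> K[of \<zeta>] by (intro mult_mono) auto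
  then show ?thesis using \<xi> \<zeta> by simp
qed

lemma first_order_remainder:
  fixes f f' :: "real \<Rightarrow> real"
  assumes "\<And>s. (f has_real_derivative f' s) (at s)"
    and K: "\<And>s. 0 \<le> s \<Longrightarrow> s \<le> 1 \<Longrightarrow> \<bar>f' s\<bar> \<le> K"
  shows "\<bar>f 1 - f 0\<bar> \<le> K"
  using MVT2[of 0 1 f f'] assms by (metis diff_zero less_eq_real_def mult_1 zero_less_one)

lemma convex_abs_le:
  fixes u \<omega> B s :: real
  assumes "\<bar>u\<bar> \<le> B" "\<bar>u + \<omega>\<bar> \<le> B" "0 \<le> s" "s \<le> 1"
  shows "\<bar>u + s * \<omega>\<bar> \<le> B"
proof -
  have "u + s * \<omega> = (1 - s) * u + s * (u + \<omega>)" by (simp add: algebra_simps)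
  also have "\<bar>\<dots>\<bar> \<le> (1 - s) * \<bar>u\<bar> + s * \<bar>u + \<omega>\<bar>"
    using assms(3,4) by (intro order_trans[OF abs_triangle_ineq]) (simp add: abs_mult)
  also have "\<dots> \<le> (1 - s) * B + s * B"
    using assms by (intro add_mono mult_left_mono) auto
  finally show ?thesis by (simp add: algebra_simps)
qed

text \<open>\<open>a\<close> and \<open>b\<close> measure the moves of the values and of the scores,
  while \<open>B\<close> bounds the values at both ends and, by convexity, in between. The second
  remainder is quadratic in the moves and grows at most like the square of \<open>B\<close>, which
  is the shape of \<open>L2\<close>.\<close>

lemma neuron_remainders:
  assumes T: "T \<ge> 1"
    and sg: "\<And>u. (sg has_real_derivative sg' u) (at u)" "\<And>u. (sg' has_real_derivative sg'' u) (at u)"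
    and bd: "\<And>u. \<bar>sg' u\<bar> \<le> \<sigma>1" "\<And>u. \<bar>sg'' u\<bar> \<le> \<sigma>2"
    and u: "\<And>t. t < T \<Longrightarrow> \<bar>u t\<bar> \<le> B" "\<And>t. t < T \<Longrightarrow> \<bar>u t + \<omega> t\<bar> \<le> B"
    and ab: "\<And>t. t < T \<Longrightarrow> \<bar>\<omega> t\<bar> \<le> a" "\<And>t. t < T \<Longrightarrow> \<bar>\<zeta> t\<bar> \<le> b"
  shows "\<bar>sg (smavg T (\<lambda>t. z t + \<zeta> t) (\<lambda>t. u t + \<omega> t)) - sg (smavg T z u)\<bar> \<le> \<sigma>1 * (a + 2 * b * B)"
    and "\<bar>sg (smavg T (\<lambda>t. z t + \<zeta> t) (\<lambda>t. u t + \<omega> t)) - sg (smavg T z u)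
          - sg' (smavg T z u) * (smavg T z \<omega> + smcov T z \<zeta> u)\<bar>
         \<le> \<sigma>2 * (a + 2 * b * B)\<^sup>2 + \<sigma>1 * (4 * a * b + 6 * b\<^sup>2 * B)"
proof -
  define zs where "zs s = (\<lambda>t. z t + s * \<zeta> t)" for s
  define us where "us s = (\<lambda>t. u t + s * \<omega> t)" for s
  define G where "G s = smavg T (zs s) (us s)" for s
  define G1 where "G1 s = smavg T (zs s) \<omega> + smcov T (zs s) \<zeta> (us s)" for s
  \<comment> \<open>This is the second derivative of \<open>G\<close>. Besides the mixed term with
    \<open>\<omega>\<close>, its three remaining terms form the joint third cumulant of
    \<open>\<zeta>\<close>, \<open>\<zeta>\<close> and the values; each is bounded by 2 * b^2 * B,
    which explains the 6 below.\<close>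
  define G2 where "G2 s = 2 * smcov T (zs s) \<zeta> \<omega> + smcov T (zs s) \<zeta> (\<lambda>t. \<zeta> t * us s t)
     - smcov T (zs s) \<zeta> \<zeta> * smavg T (zs s) (us s) - smavg T (zs s) \<zeta> * smcov T (zs s) \<zeta> (us s)" for s
  have dG: "(G has_real_derivative G1 s) (at s)" for s
    unfolding G_def[abs_def] G1_def zs_def us_def by (rule has_real_derivative_smavg[OF T])
  have dc: "((\<lambda>s. smavg T (zs s) w) has_real_derivative smcov T (zs s) \<zeta> w) (at s)" for s w
    using has_real_derivative_smavg[OF T, of z \<zeta> w "\<lambda>_. 0" s] unfolding zs_def
    by (simp add: smavg_def)
  have dp: "((\<lambda>s. smavg T (zs s) (\<lambda>t. \<zeta> t * us s t)) has_real_derivative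
      smavg T (zs s) (\<lambda>t. \<zeta> t * \<omega> t) + smcov T (zs s) \<zeta> (\<lambda>t. \<zeta> t * us s t)) (at s)" for s
    using has_real_derivative_smavg[OF T, of z \<zeta> "\<lambda>t. \<zeta> t * u t" "\<lambda>t. \<zeta> t * \<omega> t" s]
    unfolding zs_def us_def by (simp add: algebra_simps)
  have dG1: "(G1 has_real_derivative G2 s) (at s)" for s
    unfolding G1_def[abs_def] smcov_def[of T "zs _" \<zeta> "us _"]
    apply (rule derivative_eq_intros dc dp dG[unfolded G_def[abs_def]] refl)+
    unfolding G2_def G1_def smcov_def by (simp add: algebra_simps)
  have us: "\<bar>us s t\<bar> \<le> B" if "0 \<le> s" "s \<le> 1" "t < T" for s t
    unfolding us_def using that u by (intro convex_abs_le) auto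
  have pos: "0 \<le> a" "0 \<le> b" "0 \<le> B"
    using T u(1)[of 0] ab(1)[of 0] ab(2)[of 0] by auto
  have bG1: "\<bar>G1 s\<bar> \<le> a + 2 * b * B" if "0 \<le> s" "s \<le> 1" for s
    unfolding G1_def
    by (intro order_trans[OF abs_triangle_ineq] add_mono abs_smavg_le abs_smcov_le T ab us that)
  have bG2: "\<bar>G2 s\<bar> \<le> 4 * a * b + 6 * b\<^sup>2 * B" if s: "0 \<le> s" "s \<le> 1" for s
  proof -
    have 1: "\<bar>smcov T (zs s) \<zeta> \<omega>\<bar> \<le> 2 * b * a" by (intro abs_smcov_le T ab) auto
    have 2: "\<bar>smcov T (zs s) \<zeta> (\<lambda>t. \<zeta> t * us s t)\<bar> \<le> 2 * b * (b * B)"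
      using us[OF s] by (intro abs_smcov_le T ab) (auto simp: abs_mult intro!: mult_mono ab pos)
    have 3: "\<bar>smcov T (zs s) \<zeta> \<zeta> * smavg T (zs s) (us s)\<bar> \<le> (2 * b * b) * B"
      unfolding abs_mult by (intro mult_mono abs_smcov_le abs_smavg_le T ab us s) (auto simp: pos)
    have 4: "\<bar>smavg T (zs s) \<zeta> * smcov T (zs s) \<zeta> (us s)\<bar> \<le> b * (2 * b * B)"
      unfolding abs_mult by (intro mult_mono abs_smcov_le abs_smavg_le T ab us s) (auto simp: pos)
    show ?thesis unfolding G2_def using 1 2 3 4 by (simp add: power2_eq_square algebra_simps)
  qed
  have dH: "((\<lambda>s. sg (G s)) has_real_derivative sg' (G s) * G1 s) (at s)" for s
    by (rule DERIV_chain2[OF sg(1) dG])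
  have dH1: "((\<lambda>s. sg' (G s) * G1 s) has_real_derivative sg'' (G s) * (G1 s)\<^sup>2 + sg' (G s) * G2 s) (at s)" for s
    by (rule derivative_eq_intros DERIV_chain2[OF sg(2) dG] dG1 refl)+ (simp add: power2_eq_square)
  have ends: "G 1 = smavg T (\<lambda>t. z t + \<zeta> t) (\<lambda>t. u t + \<omega> t)" "G 0 = smavg T z u"
     "G1 0 = smavg T z \<omega> + smcov T z \<zeta> u"
    by (simp_all add: G_def G1_def zs_def us_def)
  have s0: "0 \<le> \<sigma>1" "0 \<le> \<sigma>2" using bd[of 0] by auto
  show "\<bar>sg (smavg T (\<lambda>t. z t + \<zeta> t) (\<lambda>t. u t + \<omega> t)) - sg (smavg T z u)\<bar> \<le> \<sigma>1 * (a + 2 * b * B)"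
    unfolding ends[symmetric]
    by (rule first_order_remainder[OF dH]) (auto simp: abs_mult intro!: mult_mono bd bG1 s0)
  show "\<bar>sg (smavg T (\<lambda>t. z t + \<zeta> t) (\<lambda>t. u t + \<omega> t)) - sg (smavg T z u)
          - sg' (smavg T z u) * (smavg T z \<omega> + smcov T z \<zeta> u)\<bar>
         \<le> \<sigma>2 * (a + 2 * b * B)\<^sup>2 + \<sigma>1 * (4 * a * b + 6 * b\<^sup>2 * B)"
    unfolding ends[symmetric]
  proof (rule second_order_remainder[OF dH dH1])
    fix s :: real assume s: "0 \<le> s" "s \<le> 1"
    have "\<bar>sg'' (G s) * (G1 s)\<^sup>2\<bar> \<le> \<sigma>2 * (a + 2 * b * B)\<^sup>2"
      unfolding abs_mult using bG1[OF s] by (intro mult_mono bd s0) (auto simp: abs_le_square_iff[symmetric])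
    moreover have "\<bar>sg' (G s) * G2 s\<bar> \<le> \<sigma>1 * (4 * a * b + 6 * b\<^sup>2 * B)"
      unfolding abs_mult by (intro mult_mono bd bG2 s0 s) auto
    ultimately show "\<bar>sg'' (G s) * (G1 s)\<^sup>2 + sg' (G s) * G2 s\<bar>
        \<le> \<sigma>2 * (a + 2 * b * B)\<^sup>2 + \<sigma>1 * (4 * a * b + 6 * b\<^sup>2 * B)" by linarith
  qed
qed


subsection \<open>Directional derivatives of the network\<close>

lemma finite_ncoords [simp]: "finite (ncoords d)"
  by (simp add: ncoords_def)

lemma ncoords_simps [simp]:
  "Nc \<in> ncoords d" "Nu k \<in> ncoords d \<longleftrightarrow> k < d" "Nw k l \<in> ncoords d \<longleftrightarrow> k < d \<and> l < d"
  by (auto simp: ncoords_def)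

lemma sum_ncoords:
  "(\<Sum>\<kappa>\<in>ncoords d. f \<kappa>) = f Nc + (\<Sum>k<d. f (Nu k)) + (\<Sum>k<d. \<Sum>l<d. f (Nw k l) :: real)"
proof -
  have "(\<Sum>\<kappa>\<in>ncoords d. f \<kappa>) = sum f ({Nc} \<union> Nu ` {..<d}) + sum f ((\<lambda>(k,l). Nw k l) ` ({..<d} \<times> {..<d}))"
    unfolding ncoords_def by (rule sum.union_disjoint) auto
  also have "sum f ({Nc} \<union> Nu ` {..<d}) = sum f {Nc} + sum f (Nu ` {..<d})"
    by (rule sum.union_disjoint) auto
  also have "sum f (Nu ` {..<d}) = (\<Sum>k<d. f (Nu k))"
    by (subst sum.reindex) (auto simp: inj_on_def)
  also have "sum f ((\<lambda>(k,l). Nw k l) ` ({..<d} \<times> {..<d})) = (\<Sum>k<d. \<Sum>l<d. f (Nw k l))"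
    by (subst sum.reindex) (auto simp: inj_on_def sum.cartesian_product intro!: sum.cong)
  finally show ?thesis by simp
qed

text \<open>By \<open>loc\<close>, the argument may be replaced by a finite combination of
  indicators, on which linearity applies. This is the bridge from directional derivatives to sums
  over partial derivatives.\<close>

lemma linear_on_coords:
  fixes L :: "('a \<Rightarrow> real) \<Rightarrow> real"
  assumes fin: "finite S"
    and add: "\<And>a b. L (\<lambda>x. a x + b x) = L a + L b"
    and scale: "\<And>c a. L (\<lambda>x. c * a x) = c * L a"
    and loc: "\<And>a b. (\<And>x. x \<in> S \<Longrightarrow> a x = b x) \<Longrightarrow> L a = L b"
  shows "L v = (\<Sum>x\<in>S. v x * L (\<lambda>y. if y = x then 1 else 0))"
proof -
  have "L (\<lambda>y. \<Sum>x\<in>A. v x * (if y = x then 1 else 0)) = (\<Sum>x\<in>A. v x * L (\<lambda>y. if y = x then 1 else 0))"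
    if "finite A" for A
    using that
  proof induction
    case empty
    show ?case using scale[of 0 "\<lambda>_. 0"] by simp
  next
    case (insert x F)
    then show ?case by (simp add: add scale)
  qed
  moreover have "L v = L (\<lambda>y. \<Sum>x\<in>S. v x * (if y = x then 1 else 0))"
    by (rule loc) (use fin in \<open>simp add: if_distrib sum.delta cong: if_cong\<close>)
  ultimately show ?thesis using fin by simp
qed

section \<open>Scalar token values, scores and block norms\<close>

definition uproj :: "nat \<Rightarrow> mat \<Rightarrow> (nat \<Rightarrow> real) \<Rightarrow> nat \<Rightarrow> real" where
  "uproj d X U t = (\<Sum>k<d. U k * X k t)"

definition normU :: "nat \<Rightarrow> (ncoord \<Rightarrow> real) \<Rightarrow> real" where
  "normU d p = sqrt (\<Sum>k<d. (p (Nu k))\<^sup>2)"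

definition normW :: "nat \<Rightarrow> (ncoord \<Rightarrow> real) \<Rightarrow> real" where
  "normW d p = sqrt (\<Sum>k<d. \<Sum>l<d. (p (Nw k l))\<^sup>2)"

lemma preact_eq_smavg:
  "preact d T q X U W = smavg T (scores d X W (q X)) (uproj d X U)"
  unfolding preact_def attn_def smavg_def uproj_def sum_distrib_left
  by (subst sum.swap) (simp add: algebra_simps)

lemma abs_sum_mult_le_sqrt:
  "\<bar>\<Sum>k\<in>A. a k * b k\<bar> \<le> sqrt (\<Sum>k\<in>A. (a k)\<^sup>2) * sqrt (\<Sum>k\<in>A. (b k :: real)\<^sup>2)"
  using Cauchy_Schwarz_ineq_sum[of a b A]
  by (metis real_sqrt_abs real_sqrt_le_iff real_sqrt_mult)

lemma abs_uproj_le: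
  assumes "inX d T X" "t < T"
  shows "\<bar>uproj d X U t\<bar> \<le> sqrt (\<Sum>k<d. (U k)\<^sup>2)"
proof -
  have "\<bar>uproj d X U t\<bar> \<le> sqrt (\<Sum>k<d. (U k)\<^sup>2) * sqrt (\<Sum>k<d. (X k t)\<^sup>2)"
    unfolding uproj_def by (rule abs_sum_mult_le_sqrt)
  also have "\<dots> \<le> sqrt (\<Sum>k<d. (U k)\<^sup>2) * 1"
    using assms by (intro mult_left_mono) (auto simp: inX_def sum_nonneg)
  finally show ?thesis by simp
qed

lemma abs_scores_le:
  assumes "inX d T X" "t < T" and q: "sqrt (\<Sum>k<d. (qx k)\<^sup>2) \<le> 1"
  shows "\<bar>scores d X W qx t\<bar> \<le> sqrt (\<Sum>k<d. \<Sum>l<d. (W k l)\<^sup>2)"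
proof -
  \<comment> \<open>The score is the inner product of token t with the vector W q; Cauchy-Schwarz on
    each row of W then bounds the length of W q by the Frobenius norm.\<close>
  have "\<bar>scores d X W qx t\<bar> \<le> sqrt (\<Sum>k<d. (\<Sum>l<d. W k l * qx l)\<^sup>2)"
    using abs_uproj_le[OF assms(1,2), of "\<lambda>k. \<Sum>l<d. W k l * qx l"]
    unfolding scores_def uproj_def by (simp add: mult.commute)
  also have "\<dots> \<le> sqrt (\<Sum>k<d. (\<Sum>l<d. (W k l)\<^sup>2) * 1)"
  proof (intro real_sqrt_le_mono sum_mono)
    fix k
    have "(\<Sum>l<d. W k l * qx l)\<^sup>2 \<le> (\<Sum>l<d. (W k l)\<^sup>2) * (\<Sum>l<d. (qx l)\<^sup>2)"
      by (rule Cauchy_Schwarz_ineq_sum)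
    also have "\<dots> \<le> (\<Sum>l<d. (W k l)\<^sup>2) * 1"
      using q by (intro mult_left_mono) (auto simp: sum_nonneg)
    finally show "(\<Sum>l<d. W k l * qx l)\<^sup>2 \<le> (\<Sum>l<d. (W k l)\<^sup>2) * 1" .
  qed
  finally show ?thesis by simp
qed

lemma uproj_add: "uproj d X (nU (\<lambda>\<kappa>. p \<kappa> + v \<kappa>)) = (\<lambda>t. uproj d X (nU p) t + uproj d X (nU v) t)"
  by (simp add: fun_eq_iff uproj_def nU_def sum.distrib algebra_simps)

lemma uproj_scale: "uproj d X (nU (\<lambda>\<kappa>. s * v \<kappa>)) = (\<lambda>t. s * uproj d X (nU v) t)"
  by (simp add: fun_eq_iff uproj_def nU_def sum_distrib_left algebra_simps)

lemma scores_add: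
  "scores d X (nW (\<lambda>\<kappa>. p \<kappa> + v \<kappa>)) qx = (\<lambda>t. scores d X (nW p) qx t + scores d X (nW v) qx t)"
  by (simp add: fun_eq_iff scores_def nW_def sum.distrib algebra_simps)

lemma scores_scale: "scores d X (nW (\<lambda>\<kappa>. s * v \<kappa>)) qx = (\<lambda>t. s * scores d X (nW v) qx t)"
  by (simp add: fun_eq_iff scores_def nW_def sum_distrib_left algebra_simps)

text \<open>Directional derivative, at the neuron \<open>p\<close> and in direction \<open>v\<close>, of \<open>c * h\<close>.\<close>

definition neuron_dir where
  "neuron_dir sg sg' d T q X p v =
     v Nc * sg (preact d T q X (nU p) (nW p)) +
     p Nc * sg' (preact d T q X (nU p) (nW p)) *
       (smavg T (scores d X (nW p) (q X)) (uproj d X (nU v))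
        + smcov T (scores d X (nW p) (q X)) (scores d X (nW v) (q X)) (uproj d X (nU p)))"

definition net_dir where
  "net_dir sg sg' d T m q X phi v =
     (1 / sqrt (real m)) * (\<Sum>i<m. neuron_dir sg sg' d T q X (phi i) (v i))"

lemma neuron_dir_add:
  "neuron_dir sg sg' d T q X p (\<lambda>\<kappa>. v \<kappa> + w \<kappa>) = neuron_dir sg sg' d T q X p v + neuron_dir sg sg' d T q X p w"
  unfolding neuron_dir_def uproj_add scores_add smavg_add smcov_add_left by (simp add: algebra_simps)

lemma neuron_dir_scale:
  "neuron_dir sg sg' d T q X p (\<lambda>\<kappa>. c * v \<kappa>) = c * neuron_dir sg sg' d T q X p v"
  unfolding neuron_dir_def uproj_scale scores_scale smavg_scale smcov_scale_left by (simp add: algebra_simps)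

lemma neuron_dir_cong:
  assumes "\<And>\<kappa>. \<kappa> \<in> ncoords d \<Longrightarrow> v \<kappa> = w \<kappa>"
  shows "neuron_dir sg sg' d T q X p v = neuron_dir sg sg' d T q X p w"
proof -
  have "uproj d X (nU v) = uproj d X (nU w)"
    using assms by (auto simp: fun_eq_iff uproj_def nU_def)
  moreover have "scores d X (nW v) (q X) = scores d X (nW w) (q X)"
    using assms by (auto simp: fun_eq_iff scores_def nW_def)
  ultimately show ?thesis using assms by (simp add: neuron_dir_def)
qed

lemma neuron_dir_coords:
  "neuron_dir sg sg' d T q X p v =
    (\<Sum>\<kappa>\<in>ncoords d. v \<kappa> * neuron_dir sg sg' d T q X p (\<lambda>\<kappa>'. if \<kappa>' = \<kappa> then 1 else 0))"
  by (rule linear_on_coords) (auto simp: neuron_dir_add neuron_dir_scale intro: neuron_dir_cong)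

text \<open>The derivative is given at every s, with \<open>net_dir\<close> taken at the moved
  point: at s = 0 it yields the partial derivatives, and on [0,1] it feeds the mean value
  bound.\<close>

lemma has_real_derivative_fnet:
  assumes T: "T \<ge> 1" and sg: "\<And>u. (sg has_real_derivative sg' u) (at u)"
  shows "((\<lambda>s. fnet sg d T m q X (\<lambda>i \<kappa>. phi i \<kappa> + s * v i \<kappa>)) has_real_derivative
     net_dir sg sg' d T m q X (\<lambda>i \<kappa>. phi i \<kappa> + s * v i \<kappa>) v) (at s)"
proof -
  have pre: "preact d T q X (nU (\<lambda>\<kappa>. p \<kappa> + s * w \<kappa>)) (nW (\<lambda>\<kappa>. p \<kappa> + s * w \<kappa>)) =
     smavg T (\<lambda>t. scores d X (nW p) (q X) t + s * scores d X (nW w) (q X) t)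
       (\<lambda>t. uproj d X (nU p) t + s * uproj d X (nU w) t)" for p w s
    by (simp add: preact_eq_smavg scores_add scores_scale uproj_add uproj_scale)
  have "((\<lambda>s. (p Nc + s * w Nc) * hneur sg d T q X (\<lambda>\<kappa>. p \<kappa> + s * w \<kappa>)) has_real_derivative
      neuron_dir sg sg' d T q X (\<lambda>\<kappa>. p \<kappa> + s * w \<kappa>) w) (at s)" for p w :: "ncoord \<Rightarrow> real"
    unfolding neuron_dir_def hneur_def pre
    unfolding scores_add scores_scale uproj_add uproj_scale
    apply (rule derivative_eq_intros DERIV_chain2[OF sg has_real_derivative_smavg[OF T]] refl)+
    by (simp add: algebra_simps)
  then show ?thesis
    unfolding net_dir_def fnet_def by (intro DERIV_cmult DERIV_sum) simp
qed

text \<open>A change of one coordinate is a line in the direction of a unit vector. The second claim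
  records differentiability, which the value of \<open>deriv\<close> alone does not give and which
  the chain rule for the loss requires.\<close>

lemma ppartial_fnet:
  assumes T: "T \<ge> 1" and sg: "\<And>u. (sg has_real_derivative sg' u) (at u)" and i: "i < m"
  shows "ppartial (fnet sg d T m q X) phi i \<kappa> =
    (1 / sqrt (real m)) * neuron_dir sg sg' d T q X (phi i) (\<lambda>\<kappa>'. if \<kappa>' = \<kappa> then 1 else 0)" (is "_ = ?r")
    and "((\<lambda>t. fnet sg d T m q X (phi(i := (phi i)(\<kappa> := phi i \<kappa> + t)))) has_real_derivative
      ppartial (fnet sg d T m q X) phi i \<kappa>) (at 0)"
proof -
  define e where "e = (\<lambda>i' \<kappa>'. if i' = i \<and> \<kappa>' = \<kappa> then 1 else 0 :: real)"
  have upd: "phi(i := (phi i)(\<kappa> := phi i \<kappa> + t)) = (\<lambda>i' \<kappa>'. phi i' \<kappa>' + t * e i' \<kappa>')" for t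
    by (auto simp: fun_eq_iff e_def)
  have z: "neuron_dir sg sg' d T q X p (\<lambda>\<kappa>'. 0) = 0" for p
    using neuron_dir_scale[of sg sg' d T q X p 0 "\<lambda>_. 0"] by simp
  have "net_dir sg sg' d T m q X phi e = (1 / sqrt (real m)) *
    (\<Sum>i'<m. if i' = i then neuron_dir sg sg' d T q X (phi i) (\<lambda>\<kappa>'. if \<kappa>' = \<kappa> then 1 else 0) else 0)"
    unfolding net_dir_def
    by (rule arg_cong[where f = "\<lambda>x. _ * x"], rule sum.cong) (auto simp: e_def z)
  also have "\<dots> = ?r" using i by simp
  finally have r: "net_dir sg sg' d T m q X phi e = ?r" .
  have d: "((\<lambda>t. fnet sg d T m q X (phi(i := (phi i)(\<kappa> := phi i \<kappa> + t)))) has_real_derivative ?r) (at 0)"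
    unfolding upd using has_real_derivative_fnet[OF T sg, of d m q X phi e 0] r by simp
  show "ppartial (fnet sg d T m q X) phi i \<kappa> = ?r"
    unfolding ppartial_def by (rule DERIV_imp_deriv[OF d])
  with d show "((\<lambda>t. fnet sg d T m q X (phi(i := (phi i)(\<kappa> := phi i \<kappa> + t)))) has_real_derivative
      ppartial (fnet sg d T m q X) phi i \<kappa>) (at 0)" by simp
qed

lemma sum_ppartial_fnet:
  assumes T: "T \<ge> 1" and sg: "\<And>u. (sg has_real_derivative sg' u) (at u)"
  shows "(\<Sum>i<m. \<Sum>\<kappa>\<in>ncoords d. ppartial (fnet sg d T m q X) phi i \<kappa> * v i \<kappa>)
    = net_dir sg sg' d T m q X phi v"
  unfolding net_dir_def sum_distrib_left
proof (rule sum.cong[OF refl])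
  fix i assume "i \<in> {..<m}"
  then have i: "i < m" by simp
  show "(\<Sum>\<kappa>\<in>ncoords d. ppartial (fnet sg d T m q X) phi i \<kappa> * v i \<kappa>)
     = (1 / sqrt (real m)) * neuron_dir sg sg' d T q X (phi i) (v i)"
    unfolding ppartial_fnet(1)[OF T sg i] neuron_dir_coords[of sg sg' d T q X "phi i" "v i"] sum_distrib_left
    by (simp add: mult_ac)
qed

text \<open>The loss gradient is always accessed through this pairing: with itself it gives the
  squared norm, with the displacement to the target it gives the descent inequality.\<close>

lemma sum_pgrad_loss:
  assumes T: "T \<ge> 1" and sg: "\<And>u. (sg has_real_derivative sg' u) (at u)"
  shows "(\<Sum>i<m. \<Sum>\<kappa>\<in>ncoords d. pgrad m d (loss sg d T m q n Xs ys) phi i \<kappa> * v i \<kappa>)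
    = (2 / real n) * (\<Sum>j<n. (fnet sg d T m q (Xs j) phi - ys j) * net_dir sg sg' d T m q (Xs j) phi v)"
proof -
  have p: "ppartial (loss sg d T m q n Xs ys) phi i \<kappa> =
     (\<Sum>j<n. (2 / real n) * (fnet sg d T m q (Xs j) phi - ys j) * ppartial (fnet sg d T m q (Xs j)) phi i \<kappa>)"
    if i: "i < m" for i \<kappa>
    unfolding ppartial_def[of "loss sg d T m q n Xs ys"] loss_def
    apply (rule DERIV_imp_deriv)
    apply (rule derivative_eq_intros ppartial_fnet(2)[OF T sg i] refl)+
    by (simp add: sum_distrib_left sum_divide_distrib algebra_simps)
  have "(\<Sum>i<m. \<Sum>\<kappa>\<in>ncoords d. pgrad m d (loss sg d T m q n Xs ys) phi i \<kappa> * v i \<kappa>)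
    = (\<Sum>i<m. \<Sum>\<kappa>\<in>ncoords d. \<Sum>j<n. (2 / real n) * (fnet sg d T m q (Xs j) phi - ys j) *
         (ppartial (fnet sg d T m q (Xs j)) phi i \<kappa> * v i \<kappa>))"
    by (intro sum.cong) (auto simp: pgrad_def p sum_distrib_right mult.assoc)
  also have "\<dots> = (\<Sum>j<n. \<Sum>i<m. \<Sum>\<kappa>\<in>ncoords d. (2 / real n) * (fnet sg d T m q (Xs j) phi - ys j) *
         (ppartial (fnet sg d T m q (Xs j)) phi i \<kappa> * v i \<kappa>))"
    by (subst sum.swap[where A = "{..<n}" and B = "{..<m}"], intro sum.cong refl, rule sum.swap)
  also have "\<dots> = (\<Sum>j<n. (2 / real n) * (fnet sg d T m q (Xs j) phi - ys j) * net_dir sg sg' d T m q (Xs j) phi v)"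
    unfolding sum_ppartial_fnet[OF T sg, symmetric] sum_distrib_left ..
  finally show ?thesis unfolding sum_distrib_left mult.assoc .
qed


subsection \<open>The parameter set and its projection\<close>

lemma normU_eq_L2_set: "normU d p = L2_set (\<lambda>k. p (Nu k)) {..<d}"
  by (simp add: normU_def L2_set_def)

lemma normW_eq_L2_set: "normW d p = L2_set (\<lambda>(k,l). p (Nw k l)) ({..<d} \<times> {..<d})"
  by (simp add: normW_def L2_set_def sum.cartesian_product split_def)

lemma normU_add: "normU d (\<lambda>\<kappa>. p \<kappa> + v \<kappa>) \<le> normU d p + normU d v"
  unfolding normU_eq_L2_set by (rule L2_set_triangle_ineq)

lemma normW_add: "normW d (\<lambda>\<kappa>. p \<kappa> + v \<kappa>) \<le> normW d p + normW d v"
  unfolding normW_eq_L2_set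
  using L2_set_triangle_ineq[of "\<lambda>(k,l). p (Nw k l)" "\<lambda>(k,l). v (Nw k l)" "{..<d} \<times> {..<d}"]
  by (simp add: split_def)

lemma normU_scale: "normU d (\<lambda>\<kappa>. c * v \<kappa>) = \<bar>c\<bar> * normU d v"
  by (simp add: normU_def power_mult_distrib real_sqrt_mult flip: sum_distrib_left)

lemma normW_scale: "normW d (\<lambda>\<kappa>. c * v \<kappa>) = \<bar>c\<bar> * normW d v"
  by (simp add: normW_def power_mult_distrib real_sqrt_mult flip: sum_distrib_left)

lemma normU_nonneg [simp]: "0 \<le> normU d p" and normW_nonneg [simp]: "0 \<le> normW d p"
  by (simp_all add: normU_def normW_def sum_nonneg)

lemma norm_minus:
  "normU d (\<lambda>\<kappa>. p \<kappa> - v \<kappa>) \<le> normU d p + normU d v"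
  "normW d (\<lambda>\<kappa>. p \<kappa> - v \<kappa>) \<le> normW d p + normW d v"
  using normU_add[of d p "\<lambda>\<kappa>. - 1 * v \<kappa>"] normW_add[of d p "\<lambda>\<kappa>. - 1 * v \<kappa>"]
  unfolding normU_scale normW_scale by simp_all

lemma norm_sum_le:
  assumes "finite S"
  shows "normU d (\<lambda>\<kappa>. \<Sum>s\<in>S. f s \<kappa>) \<le> (\<Sum>s\<in>S. normU d (f s))"
    and "normW d (\<lambda>\<kappa>. \<Sum>s\<in>S. f s \<kappa>) \<le> (\<Sum>s\<in>S. normW d (f s))"
  using assms
proof (induction S)
  case empty
  {case 1 show ?case by (simp add: normU_def)}
  {case 2 show ?case by (simp add: normW_def)}
next
  case (insert x F)
  {case 1 show ?case using insert normU_add[of d "f x" "\<lambda>\<kappa>. \<Sum>s\<in>F. f s \<kappa>"] by simp}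
  {case 2 show ?case using insert normW_add[of d "f x" "\<lambda>\<kappa>. \<Sum>s\<in>F. f s \<kappa>"] by simp}
qed

lemma Omega_iff:
  "phi \<in> Omega m d \<rho>c \<rho>u \<rho>w phi0 \<longleftrightarrow> valid m d phi \<and> (\<forall>i<m.
      \<bar>phi i Nc - phi0 i Nc\<bar> \<le> \<rho>c / sqrt (real m) \<and>
      normU d (\<lambda>\<kappa>. phi i \<kappa> - phi0 i \<kappa>) \<le> \<rho>u / sqrt (real m) \<and>
      normW d (\<lambda>\<kappa>. phi i \<kappa> - phi0 i \<kappa>) \<le> \<rho>w / sqrt (real m))"
  by (simp add: Omega_def normU_def normW_def)

lemma sum_sq_ncoords: "(\<Sum>\<kappa>\<in>ncoords d. (v \<kappa>)\<^sup>2) = (v Nc)\<^sup>2 + (normU d v)\<^sup>2 + (normW d v)\<^sup>2"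
  by (simp add: sum_ncoords normU_def normW_def sum_nonneg)

definition pnorm :: "nat \<Rightarrow> nat \<Rightarrow> param \<Rightarrow> real" where
  "pnorm m d v = sqrt (\<Sum>i<m. \<Sum>\<kappa>\<in>ncoords d. (v i \<kappa>)\<^sup>2)"

lemma pnorm_nonneg [simp]: "0 \<le> pnorm m d v"
  by (simp add: pnorm_def sum_nonneg)

text \<open>Weights of sum 1 allow \<open>phi0\<close> to be moved inside the combination, after
  which the triangle inequality acts on each block. General finite combinations are wanted for the
  averaged iterate; segments are a special case.\<close>

lemma Omega_convex_sum:
  assumes S: "finite S" and w: "\<And>s. s \<in> S \<Longrightarrow> 0 \<le> w s" "sum w S = 1"
    and x: "\<And>s. s \<in> S \<Longrightarrow> x s \<in> Omega m d \<rho>c \<rho>u \<rho>w phi0"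
  shows "(\<lambda>i \<kappa>. \<Sum>s\<in>S. w s * x s i \<kappa>) \<in> Omega m d \<rho>c \<rho>u \<rho>w phi0"
proof -
  have diff: "(\<Sum>s\<in>S. w s * x s i \<kappa>) - phi0 i \<kappa> = (\<Sum>s\<in>S. w s * (x s i \<kappa> - phi0 i \<kappa>))" for i \<kappa>
    using w(2) by (simp add: right_diff_distrib sum_subtractf flip: sum_distrib_right)
  have le: "(\<Sum>s\<in>S. w s * y s) \<le> r" if "\<And>s. s \<in> S \<Longrightarrow> y s \<le> r" for y and r :: real
  proof -
    have "(\<Sum>s\<in>S. w s * y s) \<le> (\<Sum>s\<in>S. w s * r)"
      using that w by (intro sum_mono mult_left_mono) auto
    then show ?thesis using w(2) by (simp flip: sum_distrib_right)
  qed
  show ?thesis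
    unfolding Omega_iff diff
  proof (intro conjI allI impI)
    show "valid m d (\<lambda>i \<kappa>. \<Sum>s\<in>S. w s * x s i \<kappa>)"
      using x by (auto simp: valid_def Omega_iff intro!: sum.neutral)
  next
    fix i assume i: "i < m"
    have "\<bar>\<Sum>s\<in>S. w s * (x s i Nc - phi0 i Nc)\<bar> \<le> (\<Sum>s\<in>S. w s * \<bar>x s i Nc - phi0 i Nc\<bar>)"
      using w by (intro order_trans[OF sum_abs] sum_mono) (simp add: abs_mult)
    also have "\<dots> \<le> \<rho>c / sqrt (real m)"
      using x i by (intro le) (auto simp: Omega_iff)
    finally show "\<bar>\<Sum>s\<in>S. w s * (x s i Nc - phi0 i Nc)\<bar> \<le> \<rho>c / sqrt (real m)" .
    have "normU d (\<lambda>\<kappa>. \<Sum>s\<in>S. w s * (x s i \<kappa> - phi0 i \<kappa>)) \<le> (\<Sum>s\<in>S. w s * normU d (\<lambda>\<kappa>. x s i \<kappa> - phi0 i \<kappa>))"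
      using w by (intro order_trans[OF norm_sum_le(1)[OF S]] sum_mono) (simp add: normU_scale)
    also have "\<dots> \<le> \<rho>u / sqrt (real m)"
      using x i by (intro le) (auto simp: Omega_iff)
    finally show "normU d (\<lambda>\<kappa>. \<Sum>s\<in>S. w s * (x s i \<kappa> - phi0 i \<kappa>)) \<le> \<rho>u / sqrt (real m)" .
    have "normW d (\<lambda>\<kappa>. \<Sum>s\<in>S. w s * (x s i \<kappa> - phi0 i \<kappa>)) \<le> (\<Sum>s\<in>S. w s * normW d (\<lambda>\<kappa>. x s i \<kappa> - phi0 i \<kappa>))"
      using w by (intro order_trans[OF norm_sum_le(2)[OF S]] sum_mono) (simp add: normW_scale)
    also have "\<dots> \<le> \<rho>w / sqrt (real m)"
      using x i by (intro le) (auto simp: Omega_iff)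
    finally show "normW d (\<lambda>\<kappa>. \<Sum>s\<in>S. w s * (x s i \<kappa> - phi0 i \<kappa>)) \<le> \<rho>w / sqrt (real m)" .
  qed
qed

lemma Omega_segment:
  assumes "x \<in> Omega m d \<rho>c \<rho>u \<rho>w phi0" "y \<in> Omega m d \<rho>c \<rho>u \<rho>w phi0" "0 \<le> s" "s \<le> 1"
  shows "(\<lambda>i \<kappa>. x i \<kappa> + s * (y i \<kappa> - x i \<kappa>)) \<in> Omega m d \<rho>c \<rho>u \<rho>w phi0"
  \<comment> \<open>The index set is \<open>bool\<close>: y carries weight s and x carries weight 1
    - s.\<close>
  using Omega_convex_sum[of UNIV "\<lambda>b. if b then s else 1 - s" "\<lambda>b. if b then y else x" m d \<rho>c \<rho>u \<rho>w phi0] assms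
  by (simp add: UNIV_bool algebra_simps)

text \<open>Omega is closed because coordinates are continuous in the product topology, and it lies
  in a product of compact sets: an interval for each true coordinate and the singleton {0} for all
  others, as \<open>valid\<close> prescribes.\<close>

lemma compact_Omega: "compact (Omega m d \<rho>c \<rho>u \<rho>w phi0)"
proof -
  define R where "R = (\<bar>\<rho>c\<bar> + \<bar>\<rho>u\<bar> + \<bar>\<rho>w\<bar>) / sqrt (real m)"
  define I where "I i \<kappa> = (if i < m \<and> \<kappa> \<in> ncoords d then {phi0 i \<kappa> - R .. phi0 i \<kappa> + R} else {0::real})" for i \<kappa>
  define K where "K = PiE UNIV (\<lambda>i. PiE UNIV (I i))"
  have cin: "compact (PiE UNIV J)" if "\<And>i. compact (J i)" for J :: "'b \<Rightarrow> 'c::topological_space set"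
    using that compactin_PiE[of "\<lambda>_. euclidean" UNIV J] by (simp add: euclidean_product_topology)
  have "compact K"
    unfolding K_def by (intro cin) (simp add: I_def)
  moreover have "closed (Omega m d \<rho>c \<rho>u \<rho>w phi0)"
  proof -
    have c: "continuous_on UNIV (\<lambda>phi::param. phi i \<kappa>)" for i \<kappa>
      by (rule continuous_on_product_then_coordinatewise,
          rule continuous_on_product_then_coordinatewise, rule continuous_on_id)
    have "closed {phi. valid m d phi}"
      unfolding valid_def by (intro closed_Collect_all closed_Collect_imp closed_Collect_eq c continuous_on_const) auto
    moreover have "closed {phi::param. i < m \<longrightarrow>
      \<bar>phi i Nc - phi0 i Nc\<bar> \<le> \<rho>c / sqrt (real m) \<and>
      sqrt (\<Sum>k<d. (phi i (Nu k) - phi0 i (Nu k))^2) \<le> \<rho>u / sqrt (real m) \<and>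
      sqrt (\<Sum>k<d. \<Sum>l<d. (phi i (Nw k l) - phi0 i (Nw k l))^2) \<le> \<rho>w / sqrt (real m)}" for i
      by (intro closed_Collect_imp closed_Collect_conj closed_Collect_le continuous_intros c) auto
    ultimately show ?thesis
      unfolding Omega_def by (intro closed_Collect_conj closed_Collect_all) 
  qed
  moreover have "Omega m d \<rho>c \<rho>u \<rho>w phi0 \<subseteq> K"
  proof
    fix phi assume phi: "phi \<in> Omega m d \<rho>c \<rho>u \<rho>w phi0"
    have "phi i \<kappa> \<in> I i \<kappa>" for i \<kappa>
    proof (cases "i < m \<and> \<kappa> \<in> ncoords d")
      case False
      then show ?thesis using phi by (auto simp: I_def Omega_iff valid_def)
    next
      case True
      then have i: "i < m" by simp
      have r: "x / sqrt (real m) \<le> R" if "x = \<rho>c \<or> x = \<rho>u \<or> x = \<rho>w" for x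
        unfolding R_def using that by (intro divide_right_mono) auto
      have "\<bar>phi i \<kappa> - phi0 i \<kappa>\<bar> \<le> R"
      proof (cases \<kappa>)
        case Nc
        then show ?thesis using phi i r[of \<rho>c] by (fastforce simp: Omega_iff)
      next
        case (Nu k)
        have "\<bar>phi i \<kappa> - phi0 i \<kappa>\<bar> \<le> L2_set (\<lambda>k. \<bar>phi i (Nu k) - phi0 i (Nu k)\<bar>) {..<d}"
          using True unfolding Nu by (intro member_le_L2_set) auto
        also have "\<dots> = normU d (\<lambda>\<kappa>. phi i \<kappa> - phi0 i \<kappa>)" by (simp add: normU_def L2_set_def)
        finally show ?thesis using phi i r[of \<rho>u] by (fastforce simp: Omega_iff)
      next
        case (Nw k l)
        have "\<bar>phi i \<kappa> - phi0 i \<kappa>\<bar> \<le> L2_set (\<lambda>(k,l). \<bar>phi i (Nw k l) - phi0 i (Nw k l)\<bar>) ({..<d} \<times> {..<d})"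
          using True unfolding Nw
          by (intro order_trans[OF _ member_le_L2_set[where i = "(k,l)"]]) auto
        also have "\<dots> = normW d (\<lambda>\<kappa>. phi i \<kappa> - phi0 i \<kappa>)"
          by (simp add: normW_eq_L2_set L2_set_def split_def)
        finally show ?thesis using phi i r[of \<rho>w] by (fastforce simp: Omega_iff)
      qed
      then show ?thesis using True by (auto simp: I_def abs_le_iff)
    qed
    then show "phi \<in> K" by (auto simp: K_def)
  qed
  ultimately show ?thesis
    by (metis compact_Int_closed inf.absorb_iff2)
qed

section \<open>Existence and contraction of the projection\<close>

lemma continuous_on_pdist2: "continuous_on S (\<lambda>p. pdist2 m d p x)"
proof -
  have c: "continuous_on S (\<lambda>phi::param. phi i \<kappa>)" for i \<kappa>
    by (rule continuous_on_subset[of UNIV], rule continuous_on_product_then_coordinatewise,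
        rule continuous_on_product_then_coordinatewise, rule continuous_on_id) auto
  show ?thesis unfolding pdist2_def by (intro continuous_intros c)
qed

text \<open>\<open>proj\<close> is a choice, so both properties need an actual minimizer; it exists
  since a continuous function attains its infimum on a nonempty compact set, with
  \<open>phi1\<close> as the witness of nonemptiness.\<close>

lemma proj_Omega:
  assumes "phi1 \<in> Omega m d \<rho>c \<rho>u \<rho>w phi0"
  shows "proj m d (Omega m d \<rho>c \<rho>u \<rho>w phi0) x \<in> Omega m d \<rho>c \<rho>u \<rho>w phi0"
    and "p' \<in> Omega m d \<rho>c \<rho>u \<rho>w phi0 \<Longrightarrow>
      pdist2 m d (proj m d (Omega m d \<rho>c \<rho>u \<rho>w phi0) x) x \<le> pdist2 m d p' x"
proof -
  have "\<exists>p. p \<in> Omega m d \<rho>c \<rho>u \<rho>w phi0 \<and> (\<forall>p'\<in>Omega m d \<rho>c \<rho>u \<rho>w phi0. pdist2 m d p x \<le> pdist2 m d p' x)"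
    using continuous_attains_inf[OF compact_Omega _ continuous_on_pdist2, of m d \<rho>c \<rho>u \<rho>w phi0 m d x] assms
    by blast
  from someI_ex[OF this]
  show "proj m d (Omega m d \<rho>c \<rho>u \<rho>w phi0) x \<in> Omega m d \<rho>c \<rho>u \<rho>w phi0"
    "p' \<in> Omega m d \<rho>c \<rho>u \<rho>w phi0 \<Longrightarrow>
      pdist2 m d (proj m d (Omega m d \<rho>c \<rho>u \<rho>w phi0) x) x \<le> pdist2 m d p' x"
    unfolding proj_def by blast+
qed

lemma pdist2_expand:
  "pdist2 m d (\<lambda>i \<kappa>. x i \<kappa> + s * v i \<kappa>) y =
    pdist2 m d x y + 2 * s * (\<Sum>i<m. \<Sum>\<kappa>\<in>ncoords d. (x i \<kappa> - y i \<kappa>) * v i \<kappa>) + s\<^sup>2 * (pnorm m d v)\<^sup>2"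
proof -
  have "(\<Sum>i<m. \<Sum>\<kappa>\<in>ncoords d. (x i \<kappa> + s * v i \<kappa> - y i \<kappa>)\<^sup>2) =
    (\<Sum>i<m. \<Sum>\<kappa>\<in>ncoords d. (x i \<kappa> - y i \<kappa>)\<^sup>2 + 2 * s * ((x i \<kappa> - y i \<kappa>) * v i \<kappa>) + s\<^sup>2 * (v i \<kappa>)\<^sup>2)"
    by (intro sum.cong refl) (simp add: power2_eq_square algebra_simps)
  then show ?thesis
    by (simp add: pdist2_def pnorm_def sum_nonneg sum.distrib sum_distrib_left)
qed

lemma nonneg_of_quadratic:
  fixes a b :: real
  assumes "\<And>s. 0 < s \<Longrightarrow> s \<le> 1 \<Longrightarrow> 0 \<le> 2 * s * a + s\<^sup>2 * b"
  shows "0 \<le> a"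
proof (rule ccontr)
  assume "\<not> 0 \<le> a"
  \<comment> \<open>With this s the quadratic term contributes s * b \<le> -a, so that 2 * a + s * b
    \<le> a < 0.\<close>
  define s where "s = min 1 (- a / (\<bar>b\<bar> + 1))"
  have s: "0 < s" "s \<le> 1" using \<open>\<not> 0 \<le> a\<close> by (auto simp: s_def intro!: divide_neg_pos)
  have "s * b \<le> s * (\<bar>b\<bar> + 1)" using s by (intro mult_left_mono) auto
  also have "\<dots> \<le> (- a / (\<bar>b\<bar> + 1)) * (\<bar>b\<bar> + 1)" unfolding s_def by (intro mult_right_mono) auto
  finally have "2 * a + s * b < 0" using \<open>\<not> 0 \<le> a\<close> by simp
  then have "s * (2 * a + s * b) < 0" using s by (simp add: mult_pos_neg)
  then show False using assms[OF s] by (simp add: power2_eq_square algebra_simps)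
qed

text \<open>Minimality of the projection p along the segment towards z gives the variational
  inequality (p - x) . (z - p) \<ge> 0. Expanding the squared distance from z to x around p then
  leaves at least the squared distance from z to p.\<close>

lemma proj_Omega_contracts:
  assumes z: "z \<in> Omega m d \<rho>c \<rho>u \<rho>w phi0"
  shows "pdist2 m d (proj m d (Omega m d \<rho>c \<rho>u \<rho>w phi0) x) z \<le> pdist2 m d x z"
proof -
  let ?O = "Omega m d \<rho>c \<rho>u \<rho>w phi0"
  define p where "p = proj m d ?O x"
  define v where "v = (\<lambda>i \<kappa>. z i \<kappa> - p i \<kappa>)"
  define a where "a = (\<Sum>i<m. \<Sum>\<kappa>\<in>ncoords d. (p i \<kappa> - x i \<kappa>) * v i \<kappa>)"
  have p: "p \<in> ?O" unfolding p_def by (rule proj_Omega(1)[OF z])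
  have a: "0 \<le> a"
  proof (rule nonneg_of_quadratic)
    fix s :: real assume s: "0 < s" "s \<le> 1"
    have "pdist2 m d p x \<le> pdist2 m d (\<lambda>i \<kappa>. p i \<kappa> + s * v i \<kappa>) x"
      unfolding p_def v_def by (intro proj_Omega(2)[OF z] Omega_segment proj_Omega(1)[OF z] z) (use s in auto)
    then show "0 \<le> 2 * s * a + s\<^sup>2 * (pnorm m d v)\<^sup>2"
      unfolding pdist2_expand a_def by simp
  qed
  have sym: "pdist2 m d y w = pdist2 m d w y" for y w
    unfolding pdist2_def by (simp add: power2_commute)
  have "pdist2 m d z x = pdist2 m d p x + 2 * a + (pnorm m d v)\<^sup>2"
    using pdist2_expand[of m d p 1 v x] by (simp add: v_def a_def)
  moreover have "(pnorm m d v)\<^sup>2 = pdist2 m d z p"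
    by (simp add: pnorm_def pdist2_def v_def sum_nonneg)
  moreover have "0 \<le> pdist2 m d p x" by (simp add: pdist2_def sum_nonneg)
  ultimately have "pdist2 m d z p \<le> pdist2 m d z x" using a by simp
  then show ?thesis unfolding p_def[symmetric] using sym by simp
qed


subsection \<open>Lipschitz and linearization bounds near the initialization\<close>

text \<open>The analysis is pathwise: \<open>phi0\<close> is one realization of the initialization
  inside the event, and the law of the initialization enters later only through the target
  function.\<close>

locale attention_net =
  fixes \<sigma>0 \<sigma>1 \<sigma>2 \<rho>c \<rho>u \<rho>w :: real and d T m :: nat
    and sg sg' sg'' :: "real \<Rightarrow> real" and q :: "mat \<Rightarrow> nat \<Rightarrow> real"
    and \<delta>' :: real and phi0 :: param
  assumes \<sigma>_pos: "\<sigma>0 > 0" "\<sigma>1 > 0" "\<sigma>2 > 0"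
    and \<rho>_pos: "\<rho>c > 0" "\<rho>u > 0" "\<rho>w > 0"
    and T: "T \<ge> 1" and m: "m \<ge> 1"
    and sg: "\<And>u. (sg has_real_derivative sg' u) (at u)" "\<And>u. (sg' has_real_derivative sg'' u) (at u)"
    and sg_bound: "\<And>u. \<bar>sg u\<bar> \<le> \<sigma>0" "\<And>u. \<bar>sg' u\<bar> \<le> \<sigma>1" "\<And>u. \<bar>sg'' u\<bar> \<le> \<sigma>2"
    and q: "\<And>X. inX d T X \<Longrightarrow> sqrt (\<Sum>k<d. (q X k)\<^sup>2) \<le> 1"
    and \<delta>': "0 < \<delta>'" "\<delta>' < 1"
    and init: "sym_init m d phi0" and event: "event_U d m \<delta>' phi0"
begin

abbreviation "B \<equiv> B_U d m \<rho>u \<delta>'"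
abbreviation "L\<^sub>1 \<equiv> L1 \<sigma>1 d m \<rho>u \<delta>'"
abbreviation "L\<^sub>2 \<equiv> L2 \<sigma>1 \<sigma>2 d m \<rho>u \<delta>'"
abbreviation "\<Omega> \<equiv> Omega m d \<rho>c \<rho>u \<rho>w phi0"
abbreviation "net X \<equiv> fnet sg d T m q X"
abbreviation "dnet X \<equiv> net_dir sg sg' d T m q X"

text \<open>The first summand comes from the output weight, whose partial derivative is at most
  sigma0; the second comes from U and W, with 1 + \<open>\<rho>c\<close> bounding the output weight
  and 3 taken from \<open>L1_bounds\<close>.\<close>

definition "K_grad = \<sigma>0 / \<sigma>1 + 3 * (1 + \<rho>c)"
text \<open>\<open>K_step / sqrt (real m)\<close> bounds the distance of two points of Omega in the
  U block and in the W block of one neuron.\<close>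

definition "K_step = 2 * (\<rho>u + \<rho>w)"
text \<open>The first summand is (2 * \<open>\<rho>c\<close>) * (3 * \<open>K_step\<close>), change
  of the output weight times change of the neuron; the second is the output weight times the
  second-order remainder, with 5 taken from \<open>L1_bounds\<close>.\<close>

definition "K_lin = 6 * \<rho>c * K_step + 5 * (1 + \<rho>c) * K_step\<^sup>2"

lemma K_pos: "0 < K_grad" "0 < K_step" "0 < K_lin"
proof -
  show 1: "0 < K_step" using \<rho>_pos by (simp add: K_step_def)
  show "0 < K_grad" using \<rho>_pos \<sigma>_pos by (simp add: K_grad_def add_pos_pos)
  show "0 < K_lin" unfolding K_lin_def using \<rho>_pos 1 by (intro add_pos_pos mult_pos_pos) auto
qed

lemma sqrt_d_le_B: "sqrt (real d) \<le> B"
proof -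
  \<comment> \<open>Evenness raises m \<ge> 1 to m \<ge> 2, which makes the logarithm nonnegative.
    This matters because \<open>sqrt\<close> is negative on negative arguments.\<close>
  have "even m" using init by (simp add: sym_init_def)
  then have "2 \<le> real m" using m by (auto elim: evenE)
  then have "1 \<le> real m / (2 * \<delta>')" using \<delta>' by (simp add: field_simps)
  then have "0 \<le> ln (real m / (2 * \<delta>'))" by simp
  then show ?thesis using \<rho>_pos by (simp add: B_U_def)
qed

lemma sqrt_bounds: "1 \<le> sqrt (1 + B\<^sup>2)" "B \<le> sqrt (1 + B\<^sup>2)"
  by (auto intro: real_le_rsqrt)

lemma L1_bounds: "\<sigma>1 \<le> L\<^sub>1" "\<sigma>1 * B \<le> L\<^sub>1" "0 < L\<^sub>1" "0 < L\<^sub>2"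
  "\<sigma>1 * (1 + 2 * B) \<le> 3 * L\<^sub>1"
  "\<sigma>2 * (1 + 2 * B)\<^sup>2 + \<sigma>1 * (4 + 6 * B) \<le> 5 * L\<^sub>2"
proof -
  show 1: "\<sigma>1 \<le> L\<^sub>1" and 2: "\<sigma>1 * B \<le> L\<^sub>1"
    unfolding L1_def using sqrt_bounds \<sigma>_pos by (auto intro!: mult_left_mono)
  show 3: "0 < L\<^sub>1" using 1 \<sigma>_pos by linarith
  have e: "L\<^sub>2 = \<sigma>2 * (1 + B\<^sup>2) + 8 * L\<^sub>1" by (simp add: L1_def L2_def)
  have p: "0 < \<sigma>2 * (1 + B\<^sup>2)" using \<sigma>_pos by (intro mult_pos_pos) (auto simp: add_pos_nonneg)
  show "0 < L\<^sub>2" unfolding e using 3 p by linarith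
  show "\<sigma>1 * (1 + 2 * B) \<le> 3 * L\<^sub>1" using 1 2 by (simp add: algebra_simps)
  \<comment> \<open>This square is exactly 5 * (1 + B^2) - (1 + 2 * B)^2. The linear term costs 10 *
    \<open>L\<^sub>1\<close>, well within the 40 * \<open>L\<^sub>1\<close> contained in 5 *
    \<open>L\<^sub>2\<close>.\<close>
  have "0 \<le> (2 - B)\<^sup>2" by simp
  then have "(1 + 2 * B)\<^sup>2 \<le> 5 * (1 + B\<^sup>2)" by (simp add: power2_eq_square algebra_simps)
  then have "\<sigma>2 * (1 + 2 * B)\<^sup>2 \<le> \<sigma>2 * (5 * (1 + B\<^sup>2))" using \<sigma>_pos by (intro mult_left_mono) auto
  moreover have "\<sigma>1 * (4 + 6 * B) \<le> 10 * L\<^sub>1" using 1 2 by (simp add: algebra_simps)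
  ultimately show "\<sigma>2 * (1 + 2 * B)\<^sup>2 + \<sigma>1 * (4 + 6 * B) \<le> 5 * L\<^sub>2"
    unfolding e using 3 by (simp add: algebra_simps)
qed

lemma sqrt_m: "0 < sqrt (real m)" "1 \<le> sqrt (real m)"
  using m by auto

lemma init_Nc: "i < m \<Longrightarrow> \<bar>phi0 i Nc\<bar> = 1"
proof -
  assume i: "i < m"
  have H: "\<And>i. i < m div 2 \<Longrightarrow> phi0 i Nc \<in> {-1, 1} \<and> phi0 (i + m div 2) Nc = - phi0 i Nc" and ev: "even m"
    using init by (auto simp: sym_init_def)
  show ?thesis
  proof (cases "i < m div 2")
    case True
    then show ?thesis using H[of i] by auto
  next
    case False
    then have "i - m div 2 < m div 2" "i - m div 2 + m div 2 = i" using i ev by (auto elim!: evenE)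
    then show ?thesis using H[of "i - m div 2"] by auto
  qed
qed

lemma phi0_in_Omega: "phi0 \<in> \<Omega>"
  using init \<rho>_pos sqrt_m by (auto simp: Omega_def sym_init_def intro!: divide_nonneg_pos)

lemma Omega_bounds:
  assumes "phi \<in> \<Omega>" "i < m"
  shows "normU d (phi i) \<le> B" "\<bar>phi i Nc\<bar> \<le> 1 + \<rho>c"
proof -
  have "normU d (phi i) \<le> normU d (phi0 i) + normU d (\<lambda>\<kappa>. phi i \<kappa> - phi0 i \<kappa>)"
    using normU_add[of d "phi0 i" "\<lambda>\<kappa>. phi i \<kappa> - phi0 i \<kappa>"] by simp
  also have "\<dots> \<le> B"
    using assms event by (auto simp: Omega_iff event_U_def B_U_def normU_def intro!: add_mono)
  finally show "normU d (phi i) \<le> B" .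
  have "\<rho>c / sqrt (real m) \<le> \<rho>c / 1"
    using sqrt_m \<rho>_pos by (intro divide_left_mono) auto
  moreover have "\<bar>phi i Nc - phi0 i Nc\<bar> \<le> \<rho>c / sqrt (real m)" using assms by (auto simp: Omega_iff)
  ultimately show "\<bar>phi i Nc\<bar> \<le> 1 + \<rho>c" using init_Nc[OF assms(2)] by linarith
qed

lemma Omega_diff:
  assumes "phi \<in> \<Omega>" "psi \<in> \<Omega>" "i < m"
  shows "\<bar>psi i Nc - phi i Nc\<bar> \<le> 2 * \<rho>c / sqrt (real m)"
    "normU d (\<lambda>\<kappa>. psi i \<kappa> - phi i \<kappa>) \<le> K_step / sqrt (real m)"
    "normW d (\<lambda>\<kappa>. psi i \<kappa> - phi i \<kappa>) \<le> K_step / sqrt (real m)"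
proof -
  have H: "\<bar>phi i Nc - phi0 i Nc\<bar> \<le> \<rho>c / sqrt (real m)" "\<bar>psi i Nc - phi0 i Nc\<bar> \<le> \<rho>c / sqrt (real m)"
    "normU d (\<lambda>\<kappa>. phi i \<kappa> - phi0 i \<kappa>) \<le> \<rho>u / sqrt (real m)" "normU d (\<lambda>\<kappa>. psi i \<kappa> - phi0 i \<kappa>) \<le> \<rho>u / sqrt (real m)"
    "normW d (\<lambda>\<kappa>. phi i \<kappa> - phi0 i \<kappa>) \<le> \<rho>w / sqrt (real m)" "normW d (\<lambda>\<kappa>. psi i \<kappa> - phi0 i \<kappa>) \<le> \<rho>w / sqrt (real m)"
    using assms by (auto simp: Omega_iff)
  have K: "2 * (\<rho>u / sqrt (real m)) \<le> K_step / sqrt (real m)" "2 * (\<rho>w / sqrt (real m)) \<le> K_step / sqrt (real m)"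
    using \<rho>_pos sqrt_m by (auto simp: K_step_def field_simps)
  show "\<bar>psi i Nc - phi i Nc\<bar> \<le> 2 * \<rho>c / sqrt (real m)" using H(1,2) by linarith
  show "normU d (\<lambda>\<kappa>. psi i \<kappa> - phi i \<kappa>) \<le> K_step / sqrt (real m)"
    using norm_minus(1)[of d "\<lambda>\<kappa>. psi i \<kappa> - phi0 i \<kappa>" "\<lambda>\<kappa>. phi i \<kappa> - phi0 i \<kappa>"] H K by simp
  show "normW d (\<lambda>\<kappa>. psi i \<kappa> - phi i \<kappa>) \<le> K_step / sqrt (real m)"
    using norm_minus(2)[of d "\<lambda>\<kappa>. psi i \<kappa> - phi0 i \<kappa>" "\<lambda>\<kappa>. phi i \<kappa> - phi0 i \<kappa>"] H K by simp
qed

text \<open>Each of the m neurons contributes 1/m of the squared radii, so the radius of Omega is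
  independent of m.\<close>

lemma pnorm_Omega:
  assumes "phi \<in> \<Omega>"
  shows "(pnorm m d (\<lambda>i \<kappa>. phi i \<kappa> - phi0 i \<kappa>))\<^sup>2 \<le> \<rho>c\<^sup>2 + \<rho>u\<^sup>2 + \<rho>w\<^sup>2"
proof -
  have "(pnorm m d (\<lambda>i \<kappa>. phi i \<kappa> - phi0 i \<kappa>))\<^sup>2 = (\<Sum>i<m. \<Sum>\<kappa>\<in>ncoords d. (phi i \<kappa> - phi0 i \<kappa>)\<^sup>2)"
    by (simp add: pnorm_def sum_nonneg)
  also have "\<dots> \<le> (\<Sum>i<m. (\<rho>c / sqrt (real m))\<^sup>2 + (\<rho>u / sqrt (real m))\<^sup>2 + (\<rho>w / sqrt (real m))\<^sup>2)"
  proof (rule sum_mono)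
    fix i assume "i \<in> {..<m}"
    then have "\<bar>phi i Nc - phi0 i Nc\<bar> \<le> \<rho>c / sqrt (real m)"
      "normU d (\<lambda>\<kappa>. phi i \<kappa> - phi0 i \<kappa>) \<le> \<rho>u / sqrt (real m)"
      "normW d (\<lambda>\<kappa>. phi i \<kappa> - phi0 i \<kappa>) \<le> \<rho>w / sqrt (real m)"
      using assms by (auto simp: Omega_iff)
    then show "(\<Sum>\<kappa>\<in>ncoords d. (phi i \<kappa> - phi0 i \<kappa>)\<^sup>2) \<le>
        (\<rho>c / sqrt (real m))\<^sup>2 + (\<rho>u / sqrt (real m))\<^sup>2 + (\<rho>w / sqrt (real m))\<^sup>2"
      unfolding sum_sq_ncoords power2_abs[of "phi i Nc - phi0 i Nc", symmetric]
      by (intro add_mono power_mono) auto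
  qed
  also have "\<dots> = \<rho>c\<^sup>2 + \<rho>u\<^sup>2 + \<rho>w\<^sup>2"
    using m by (simp add: power_divide field_simps)
  finally show ?thesis .
qed

section \<open>Bounds at one fixed input\<close>

context
  fixes X :: mat
  assumes X: "inX d T X"
begin

lemma uproj_le: "t < T \<Longrightarrow> \<bar>uproj d X (nU p) t\<bar> \<le> normU d p"
  using abs_uproj_le[OF X, of t "nU p"] by (simp add: normU_def nU_def)

lemma scores_le: "t < T \<Longrightarrow> \<bar>scores d X (nW p) (q X) t\<bar> \<le> normW d p"
  using abs_scores_le[OF X _ q[OF X], of t "nW p"] by (simp add: normW_def nW_def)

lemma neuron_dir_le:
  assumes p: "normU d p \<le> B" "\<bar>p Nc\<bar> \<le> 1 + \<rho>c"
  shows "\<bar>neuron_dir sg sg' d T q X p v\<bar> \<le> K_grad * L\<^sub>1 * sqrt (\<Sum>\<kappa>\<in>ncoords d. (v \<kappa>)\<^sup>2)"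
proof -
  define N where "N = sqrt (\<Sum>\<kappa>\<in>ncoords d. (v \<kappa>)\<^sup>2)"
  have N: "\<bar>v Nc\<bar> \<le> N" "normU d v \<le> N" "normW d v \<le> N"
    unfolding N_def sum_sq_ncoords by (auto intro!: real_le_rsqrt)
  have N0: "0 \<le> N" using N(1) by linarith
  define pa where "pa = preact d T q X (nU p) (nW p)"
  have s: "\<bar>smavg T (scores d X (nW p) (q X)) (uproj d X (nU v))
        + smcov T (scores d X (nW p) (q X)) (scores d X (nW v) (q X)) (uproj d X (nU p))\<bar> \<le> N + 2 * N * B"
    using N p(1)
    by (intro order_trans[OF abs_triangle_ineq] add_mono abs_smavg_le abs_smcov_le T)
      (auto intro: order_trans[OF uproj_le] order_trans[OF scores_le])
  have "\<bar>p Nc * sg' pa *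
      (smavg T (scores d X (nW p) (q X)) (uproj d X (nU v))
        + smcov T (scores d X (nW p) (q X)) (scores d X (nW v) (q X)) (uproj d X (nU p)))\<bar>
      \<le> (1 + \<rho>c) * \<sigma>1 * (N + 2 * N * B)"
    unfolding abs_mult using \<rho>_pos \<sigma>_pos by (intro mult_mono p s sg_bound) auto
  also have "\<dots> = ((1 + \<rho>c) * N) * (\<sigma>1 * (1 + 2 * B))" by (simp add: algebra_simps)
  also have "\<dots> \<le> ((1 + \<rho>c) * N) * (3 * L\<^sub>1)"
    using \<rho>_pos N0 by (intro mult_left_mono L1_bounds) auto
  finally have 1: "\<bar>p Nc * sg' pa *
      (smavg T (scores d X (nW p) (q X)) (uproj d X (nU v))
        + smcov T (scores d X (nW p) (q X)) (scores d X (nW v) (q X)) (uproj d X (nU p)))\<bar>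
      \<le> ((1 + \<rho>c) * N) * (3 * L\<^sub>1)" .
  \<comment> \<open>Writing sigma0 as (sigma0 / sigma1) * sigma1 lets
    \<open>\<sigma>1 \<le> L\<^sub>1\<close> turn it into a multiple of
    \<open>L\<^sub>1\<close>.\<close>
  have "\<bar>v Nc * sg pa\<bar> \<le> N * (\<sigma>0 / \<sigma>1 * \<sigma>1)"
    unfolding abs_mult using N N0 \<sigma>_pos sg_bound(1) by (intro mult_mono) auto
  also have "\<dots> \<le> N * (\<sigma>0 / \<sigma>1 * L\<^sub>1)"
    using N0 \<sigma>_pos by (intro mult_left_mono L1_bounds) auto
  finally have 2: "\<bar>v Nc * sg pa\<bar> \<le> N * (\<sigma>0 / \<sigma>1 * L\<^sub>1)" .
  have "K_grad * L\<^sub>1 * N = N * (\<sigma>0 / \<sigma>1 * L\<^sub>1) + ((1 + \<rho>c) * N) * (3 * L\<^sub>1)"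
    by (simp add: K_grad_def algebra_simps)
  then show ?thesis
    using 1 2 unfolding neuron_dir_def pa_def[symmetric] N_def[symmetric] by linarith
qed

text \<open>Cauchy-Schwarz over the neurons costs sqrt m, which the prefactor of the network
  cancels.\<close>

lemma dnet_le:
  assumes "phi \<in> \<Omega>"
  shows "\<bar>dnet X phi v\<bar> \<le> K_grad * L\<^sub>1 * pnorm m d v"
proof -
  define N where "N i = sqrt (\<Sum>\<kappa>\<in>ncoords d. (v i \<kappa>)\<^sup>2)" for i
  have "\<bar>\<Sum>i<m. neuron_dir sg sg' d T q X (phi i) (v i)\<bar> \<le> (\<Sum>i<m. K_grad * L\<^sub>1 * N i)"
    unfolding N_def using Omega_bounds[OF assms]
    by (intro order_trans[OF sum_abs] sum_mono neuron_dir_le) auto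
  also have "\<dots> = K_grad * L\<^sub>1 * (\<Sum>i<m. 1 * N i)" by (simp add: sum_distrib_left)
  also have "\<dots> \<le> K_grad * L\<^sub>1 * (sqrt (real m) * pnorm m d v)"
  proof (rule mult_left_mono)
    have "pnorm m d v = sqrt (\<Sum>i<m. (N i)\<^sup>2)"
      by (simp add: pnorm_def N_def sum_nonneg)
    then show "(\<Sum>i<m. 1 * N i) \<le> sqrt (real m) * pnorm m d v"
      using abs_sum_mult_le_sqrt[of "\<lambda>_. 1" N "{..<m}"] by simp
    show "0 \<le> K_grad * L\<^sub>1" using K_pos L1_bounds by simp
  qed
  finally have "\<bar>\<Sum>i<m. neuron_dir sg sg' d T q X (phi i) (v i)\<bar> \<le> K_grad * L\<^sub>1 * (sqrt (real m) * pnorm m d v)" .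
  then show ?thesis unfolding net_dir_def using sqrt_m by (simp add: abs_mult field_simps)
qed

text \<open>Neurons i and i + m/2 share their hidden weights and have opposite output weights, so
  they cancel in pairs.\<close>

lemma net_phi0: "net X phi0 = 0"
proof -
  define k where "k = m div 2"
  have H: "\<And>i. i < k \<Longrightarrow> phi0 (i + k) Nc = - phi0 i Nc" "m = k + k"
     "\<And>i \<kappa>. i < k \<Longrightarrow> \<kappa> \<in> ncoords d \<Longrightarrow> \<kappa> \<noteq> Nc \<Longrightarrow> phi0 (i + k) \<kappa> = phi0 i \<kappa>"
    using init unfolding sym_init_def k_def by (auto elim!: evenE)
  have h: "hneur sg d T q X (phi0 (i + k)) = hneur sg d T q X (phi0 i)" if "i < k" for i
  proof -
    have "uproj d X (nU (phi0 (i + k))) = uproj d X (nU (phi0 i))"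
      using H(3)[OF that] by (auto simp: uproj_def nU_def fun_eq_iff)
    moreover have "scores d X (nW (phi0 (i + k))) (q X) = scores d X (nW (phi0 i)) (q X)"
      using H(3)[OF that] by (auto simp: scores_def nW_def fun_eq_iff)
    ultimately show ?thesis by (simp add: hneur_def preact_eq_smavg)
  qed
  define f where "f i = phi0 i Nc * hneur sg d T q X (phi0 i)" for i
  have "(\<Sum>i<m. f i) = (\<Sum>i = 0..<k. f i) + (\<Sum>i = k..<k + k. f i)"
    unfolding H(2) lessThan_atLeast0 by (subst sum.atLeastLessThan_concat) auto
  also have "(\<Sum>i = k..<k + k. f i) = (\<Sum>i = 0..<k. f (i + k))"
    using sum.shift_bounds_nat_ivl[of f 0 k k] by simp
  also have "(\<Sum>i = 0..<k. f (i + k)) = (\<Sum>i = 0..<k. - f i)"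
    by (intro sum.cong) (auto simp: f_def h H(1))
  finally have "(\<Sum>i<m. f i) = 0" by (simp add: sum_negf)
  then show ?thesis by (simp add: fnet_def f_def)
qed

text \<open>Since the network vanishes at the initialization, the gradient bound along the segment
  from \<open>phi0\<close> controls the output itself, uniformly in m.\<close>

lemma net_diff_le:
  assumes "phi \<in> \<Omega>"
  shows "\<bar>net X phi\<bar> \<le> K_grad * L\<^sub>1 * sqrt (\<rho>c\<^sup>2 + \<rho>u\<^sup>2 + \<rho>w\<^sup>2)"
proof -
  define v where "v = (\<lambda>i \<kappa>. phi i \<kappa> - phi0 i \<kappa>)"
  have "\<bar>net X (\<lambda>i \<kappa>. phi0 i \<kappa> + 1 * v i \<kappa>) - net X (\<lambda>i \<kappa>. phi0 i \<kappa> + 0 * v i \<kappa>)\<bar> \<le> K_grad * L\<^sub>1 * pnorm m d v"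
    by (rule first_order_remainder[OF has_real_derivative_fnet[OF T sg(1)]], rule dnet_le)
      (auto simp: v_def intro!: Omega_segment phi0_in_Omega assms)
  also have "\<dots> \<le> K_grad * L\<^sub>1 * sqrt (\<rho>c\<^sup>2 + \<rho>u\<^sup>2 + \<rho>w\<^sup>2)"
    using pnorm_Omega[OF assms] K_pos L1_bounds
    by (intro mult_left_mono real_le_rsqrt) (auto simp: v_def)
  finally show ?thesis by (simp add: v_def net_phi0)
qed

text \<open>Every block moves by O(1 / sqrt m), and what remains after subtracting the linear part
  is quadratic in the moves; hence the rate 1/m for a single neuron.\<close>

lemma neuron_linearization:
  assumes phi: "phi \<in> \<Omega>" and psi: "psi \<in> \<Omega>" and i: "i < m"
  shows "\<bar>psi i Nc * hneur sg d T q X (psi i) - phi i Nc * hneur sg d T q X (phi i)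
     - neuron_dir sg sg' d T q X (phi i) (\<lambda>\<kappa>. psi i \<kappa> - phi i \<kappa>)\<bar> \<le> K_lin * (L\<^sub>1 + L\<^sub>2) / real m"
proof -
  define v where "v = (\<lambda>\<kappa>. psi i \<kappa> - phi i \<kappa>)"
  define e where "e = K_step / sqrt (real m)"
  have e0: "0 \<le> e" using K_pos sqrt_m by (simp add: e_def)
  have psi_eq: "psi i = (\<lambda>\<kappa>. phi i \<kappa> + v \<kappa>)" by (simp add: v_def)
  define z u \<zeta> \<omega> where "z = scores d X (nW (phi i)) (q X)" and "u = uproj d X (nU (phi i))"
    and "\<zeta> = scores d X (nW v) (q X)" and "\<omega> = uproj d X (nU v)"
  define H where "H = sg (smavg T z u)"
  define H' where "H' = sg (smavg T (\<lambda>t. z t + \<zeta> t) (\<lambda>t. u t + \<omega> t))"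
  define S where "S = sg' (smavg T z u) * (smavg T z \<omega> + smcov T z \<zeta> u)"
  have u: "\<bar>u t\<bar> \<le> B" "\<bar>u t + \<omega> t\<bar> \<le> B" if "t < T" for t
    using uproj_le[OF that, of "phi i"] uproj_le[OF that, of "psi i"] Omega_bounds(1)[OF phi i] Omega_bounds(1)[OF psi i]
    by (auto simp: u_def \<omega>_def psi_eq uproj_add)
  have \<omega>: "\<bar>\<omega> t\<bar> \<le> e" "\<bar>\<zeta> t\<bar> \<le> e" if "t < T" for t
    using uproj_le[OF that, of v] scores_le[OF that, of v] Omega_diff[OF phi psi i]
    by (auto simp: \<omega>_def \<zeta>_def e_def v_def)
  have "\<bar>H' - H\<bar> \<le> \<sigma>1 * (e + 2 * e * B)"
    unfolding H_def H'_def by (rule neuron_remainders(1)[OF T sg sg_bound(2,3) u \<omega>])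
  also have "\<dots> = e * (\<sigma>1 * (1 + 2 * B))" by (simp add: algebra_simps)
  also have "\<dots> \<le> e * (3 * L\<^sub>1)" by (intro mult_left_mono L1_bounds e0)
  finally have 1: "\<bar>H' - H\<bar> \<le> e * (3 * L\<^sub>1)" .
  have "\<bar>H' - H - S\<bar> \<le> \<sigma>2 * (e + 2 * e * B)\<^sup>2 + \<sigma>1 * (4 * e * e + 6 * e\<^sup>2 * B)"
    unfolding H_def H'_def S_def by (rule neuron_remainders(2)[OF T sg sg_bound(2,3) u \<omega>])
  also have "\<dots> = e\<^sup>2 * (\<sigma>2 * (1 + 2 * B)\<^sup>2 + \<sigma>1 * (4 + 6 * B))"
    by (simp add: algebra_simps power2_eq_square)
  also have "\<dots> \<le> e\<^sup>2 * (5 * L\<^sub>2)" by (intro mult_left_mono L1_bounds) auto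
  finally have 2: "\<bar>H' - H - S\<bar> \<le> e\<^sup>2 * (5 * L\<^sub>2)" .
  \<comment> \<open>The remainder of the product c * h splits into the change of c times the change
    of h, and c times the second-order remainder of h.\<close>
  have "\<bar>v Nc * (H' - H) + phi i Nc * (H' - H - S)\<bar>
     \<le> (2 * \<rho>c / sqrt (real m)) * (e * (3 * L\<^sub>1)) + (1 + \<rho>c) * (e\<^sup>2 * (5 * L\<^sub>2))"
    unfolding v_def using \<rho>_pos sqrt_m
    by (intro order_trans[OF abs_triangle_ineq] add_mono; unfold abs_mult)
      (intro mult_mono 1 2 Omega_diff[OF phi psi i] Omega_bounds(2)[OF phi i]; simp)+
  also have "\<dots> = (6 * \<rho>c * K_step * L\<^sub>1 + 5 * (1 + \<rho>c) * K_step\<^sup>2 * L\<^sub>2) / real m"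
    using sqrt_m m by (simp add: e_def power_divide field_simps)
  also have "\<dots> \<le> K_lin * (L\<^sub>1 + L\<^sub>2) / real m"
  proof (rule divide_right_mono)
    have "0 \<le> 6 * \<rho>c * K_step * L\<^sub>2" "0 \<le> 5 * (1 + \<rho>c) * K_step\<^sup>2 * L\<^sub>1"
      using \<rho>_pos K_pos L1_bounds by auto
    then show "6 * \<rho>c * K_step * L\<^sub>1 + 5 * (1 + \<rho>c) * K_step\<^sup>2 * L\<^sub>2 \<le> K_lin * (L\<^sub>1 + L\<^sub>2)"
      unfolding K_lin_def by (simp add: algebra_simps)
  qed auto
  also have "v Nc * (H' - H) + phi i Nc * (H' - H - S) =
     psi i Nc * hneur sg d T q X (psi i) - phi i Nc * hneur sg d T q X (phi i)
     - neuron_dir sg sg' d T q X (phi i) v"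
    unfolding neuron_dir_def hneur_def preact_eq_smavg psi_eq scores_add uproj_add
    unfolding z_def[symmetric] u_def[symmetric] \<zeta>_def[symmetric] \<omega>_def[symmetric]
    by (simp add: H_def H'_def S_def algebra_simps)
  finally show ?thesis by (simp add: v_def)
qed

text \<open>The m errors of order 1/m add up to order 1, and the prefactor of the network supplies
  the 1 / sqrt m.\<close>

lemma linearization_error:
  assumes phi: "phi \<in> \<Omega>" and psi: "psi \<in> \<Omega>"
  shows "\<bar>net X psi - net X phi - dnet X phi (\<lambda>i \<kappa>. psi i \<kappa> - phi i \<kappa>)\<bar> \<le> K_lin * (L\<^sub>1 + L\<^sub>2) / sqrt (real m)"
proof -
  define e where "e i = psi i Nc * hneur sg d T q X (psi i) - phi i Nc * hneur sg d T q X (phi i)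
     - neuron_dir sg sg' d T q X (phi i) (\<lambda>\<kappa>. psi i \<kappa> - phi i \<kappa>)" for i
  have "\<bar>\<Sum>i<m. e i\<bar> \<le> (\<Sum>i<m. K_lin * (L\<^sub>1 + L\<^sub>2) / real m)"
    unfolding e_def by (intro order_trans[OF sum_abs] sum_mono neuron_linearization assms) auto
  also have "\<dots> = K_lin * (L\<^sub>1 + L\<^sub>2)" using m by simp
  finally have "\<bar>(1 / sqrt (real m)) * (\<Sum>i<m. e i)\<bar> \<le> K_lin * (L\<^sub>1 + L\<^sub>2) / sqrt (real m)"
    using sqrt_m by (simp add: abs_mult divide_right_mono)
  also have "(1 / sqrt (real m)) * (\<Sum>i<m. e i) = net X psi - net X phi - dnet X phi (\<lambda>i \<kappa>. psi i \<kappa> - phi i \<kappa>)"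
    by (simp add: e_def fnet_def net_dir_def sum_subtractf right_diff_distrib diff_divide_distrib)
  finally show ?thesis .
qed

end

end


subsection \<open>Bounds on the target function\<close>

text \<open>If f is not integrable its integral is 0 by convention, and the bound holds because the
  domination forces g \<ge> 0.\<close>

lemma abs_integral_le_of_dominated:
  fixes f g :: "'a \<Rightarrow> real"
  assumes g: "integrable M g" and le: "\<And>x. x \<in> space M \<Longrightarrow> \<bar>f x\<bar> \<le> g x"
  shows "\<bar>integral\<^sup>L M f\<bar> \<le> integral\<^sup>L M g"
proof (cases "integrable M f")
  case True
  then have "(\<integral>x. \<bar>f x\<bar> \<partial>M) \<le> integral\<^sup>L M g" by (intro integral_mono g le) auto
  then show ?thesis using integral_abs_bound[of M f] by linarith
next
  case False
  have "0 \<le> integral\<^sup>L M g"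
    by (rule Bochner_Integration.integral_nonneg) (use le in \<open>fastforce intro: order_trans[OF abs_ge_zero]\<close>)
  then show ?thesis using False by (simp add: not_integrable_integral_eq)
qed

section \<open>Moments of the law of one neuron at initialization\<close>

lemma space_law0: "space (law0 d) = PiE (ncoords d) (\<lambda>_. UNIV)"
proof -
  have "space (law0 d) = PiE (ncoords d) (\<lambda>\<kappa>. space (if \<kappa> = Nc then rademacher else density lborel std_normal_density))"
    unfolding law0_def space_PiM ..
  also have "\<dots> = PiE (ncoords d) (\<lambda>_. UNIV)"
    by (intro PiE_cong) (simp add: rademacher_def)
  finally show ?thesis .
qed

lemma prob_space_law0_factor:
  "prob_space (if \<kappa> = Nc then rademacher else density lborel std_normal_density)"
  using prob_space_normal_density[of 1 0]
  by (auto simp: rademacher_def intro!: prob_space.prob_space_distr prob_space_measure_pmf)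

lemma prob_space_law0: "prob_space (law0 d)"
  unfolding law0_def by (rule prob_space_PiM) (rule prob_space_law0_factor)

lemma law0_second_moment:
  assumes k: "k < d"
  shows "has_bochner_integral (law0 d) (\<lambda>p. (p (Nu k))\<^sup>2) 1"
proof -
  define N :: "ncoord \<Rightarrow> real measure"
    where "N \<kappa> = (if \<kappa> = Nc then rademacher else density lborel std_normal_density)" for \<kappa>
  have law: "law0 d = PiM (ncoords d) N" by (simp add: law0_def N_def[abs_def])
  have Nk: "N (Nu k) = density lborel std_normal_density" by (simp add: N_def)
  have dist: "distr (law0 d) (N (Nu k)) (\<lambda>p. p (Nu k)) = N (Nu k)"
    unfolding law using k prob_space_law0_factor by (intro distr_PiM_component) (auto simp: N_def)
  have "has_bochner_integral lborel (\<lambda>x. std_normal_density x *\<^sub>R x\<^sup>2) 1"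
    using std_normal_moment_even[of 1] by simp
  then have "has_bochner_integral (N (Nu k)) (\<lambda>x. x\<^sup>2) 1"
    unfolding Nk by (intro has_bochner_integral_density) (auto simp: normal_density_nonneg)
  then have "has_bochner_integral (distr (law0 d) (N (Nu k)) (\<lambda>p. p (Nu k))) (\<lambda>x. x\<^sup>2) 1"
    unfolding dist .
  moreover have "(\<lambda>p. p (Nu k)) \<in> measurable (law0 d) (N (Nu k))"
    unfolding law using k by (intro measurable_component_singleton) simp
  moreover have "(\<lambda>x. x\<^sup>2) \<in> borel_measurable (N (Nu k))" unfolding Nk by simp
  ultimately show ?thesis
    by (auto simp: has_bochner_integral_iff integrable_distr_eq integral_distr)
qed

text \<open>The AM-GM majorant of the norm of U, balanced at sqrt d: it is polynomial in the
  coordinates, and its expectation is exactly sqrt d because the second moments sum to d.\<close>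

lemma integrable_normU_dominator:
  assumes d: "d \<ge> 1"
  shows "has_bochner_integral (law0 d) (\<lambda>p. ((\<Sum>k<d. (p (Nu k))\<^sup>2) + real d) / (2 * sqrt (real d))) (sqrt (real d))"
proof -
  interpret prob_space "law0 d" by (rule prob_space_law0)
  have "has_bochner_integral (law0 d) (\<lambda>p. (\<Sum>k<d. (p (Nu k))\<^sup>2)) (\<Sum>k<d. 1)"
    by (intro has_bochner_integral_sum law0_second_moment) auto
  moreover have "has_bochner_integral (law0 d) (\<lambda>p. real d) (real d)"
    by (simp add: has_bochner_integral_iff prob_space)
  ultimately have "has_bochner_integral (law0 d) (\<lambda>p. ((\<Sum>k<d. (p (Nu k))\<^sup>2) + real d) / (2 * sqrt (real d)))
     (((\<Sum>k<d. 1) + real d) / (2 * sqrt (real d)))"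
    using d by (intro has_bochner_integral_divide_zero has_bochner_integral_add) auto
  also have "((\<Sum>k<d. 1) + real d) / (2 * sqrt (real d)) = sqrt (real d)"
    using d by (simp add: field_simps)
  finally show ?thesis .
qed

lemma normU_le_dominator:
  assumes d: "d \<ge> 1"
  shows "normU d p \<le> ((\<Sum>k<d. (p (Nu k))\<^sup>2) + real d) / (2 * sqrt (real d))"
proof -
  have "0 \<le> (normU d p - sqrt (real d))\<^sup>2" by simp
  then have "normU d p * (2 * sqrt (real d)) \<le> (normU d p)\<^sup>2 + real d"
    by (simp add: power2_diff algebra_simps)
  moreover have "(normU d p)\<^sup>2 = (\<Sum>k<d. (p (Nu k))\<^sup>2)" by (simp add: normU_def sum_nonneg)
  ultimately show ?thesis using d by (simp add: pos_le_divide_eq)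
qed

lemma sum_attn_mult: "(\<Sum>k<d. attn d T q X W k * a k) = smavg T (scores d X W (q X)) (uproj d X a)"
  using preact_eq_smavg[of d T q X a W] by (simp add: preact_def mult.commute)

text \<open>diag(s) - s s^T is the covariance matrix of the categorical distribution s, so the
  bilinear form of \<open>Mmat\<close> is the softmax covariance of the scalar token values of a and
  b.\<close>

lemma sum_Mmat_mult:
  "(\<Sum>k<d. (\<Sum>k'<d. Mmat d T q X W k k' * b k') * a k) =
    smcov T (scores d X W (q X)) (uproj d X a) (uproj d X b)"
proof -
  define s where "s = softmax T (scores d X W (q X))"
  define J where "J = softmax_jac T (scores d X W (q X))"
  have "(\<Sum>k<d. (\<Sum>k'<d. Mmat d T q X W k k' * b k') * a k) =
    (\<Sum>k<d. \<Sum>k'<d. \<Sum>t<T. \<Sum>t'<T. J t t' * (a k * X k t) * (b k' * X k' t'))"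
    unfolding Mmat_def sum_distrib_right sum_distrib_left J_def by (simp add: mult_ac)
  also have "\<dots> = (\<Sum>k<d. \<Sum>t<T. \<Sum>k'<d. \<Sum>t'<T. J t t' * (a k * X k t) * (b k' * X k' t'))"
    by (intro sum.cong refl sum.swap)
  also have "\<dots> = (\<Sum>t<T. \<Sum>k<d. \<Sum>t'<T. \<Sum>k'<d. J t t' * (a k * X k t) * (b k' * X k' t'))"
    by (subst sum.swap) (intro sum.cong refl sum.swap)
  also have "\<dots> = (\<Sum>t<T. \<Sum>t'<T. \<Sum>k<d. \<Sum>k'<d. J t t' * (a k * X k t) * (b k' * X k' t'))"
    by (intro sum.cong refl sum.swap)
  also have "\<dots> = (\<Sum>t<T. \<Sum>t'<T. J t t' * uproj d X a t * uproj d X b t')"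
    unfolding uproj_def by (simp add: sum_distrib_left sum_distrib_right mult_ac)
  also have "\<dots> = (\<Sum>t<T. \<Sum>t'<T. (if t = t' then s t * uproj d X a t * uproj d X b t' else 0)
      - (s t * uproj d X a t) * (s t' * uproj d X b t'))"
    unfolding J_def softmax_jac_def s_def by (intro sum.cong refl) (simp add: algebra_simps)
  also have "\<dots> = (\<Sum>t<T. s t * uproj d X a t * uproj d X b t)
      - (\<Sum>t<T. s t * uproj d X a t) * (\<Sum>t'<T. s t' * uproj d X b t')"
    by (simp add: sum_subtractf sum_product)
  finally show ?thesis by (simp add: smcov_def smavg_def s_def mult.assoc)
qed

context attention_net
begin

text \<open>Labels must be O(\<open>L\<^sub>1\<close>) for the residual to be. The W feature grows
  with the norm of U, whose mean is at most sqrt d, and \<open>sqrt_d_le_B\<close> hides this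
  dimension in \<open>L\<^sub>1\<close>.\<close>

lemma ftilde_le:
  assumes X: "inX d T X" and V: "inV d \<nu>c \<nu>u \<nu>w vc vu vw" and d: "d \<ge> 1"
    and \<nu>: "\<nu>c > 0" "\<nu>u > 0" "\<nu>w > 0"
  shows "\<bar>ftilde sg sg' d T q vc vu vw X\<bar> \<le> (\<sigma>0 * \<nu>c / \<sigma>1 + \<nu>u + 2 * \<nu>w) * L\<^sub>1"
proof -
  interpret law: prob_space "law0 d" by (rule prob_space_law0)
  have V': "\<bar>vc p\<bar> \<le> \<nu>c" "sqrt (\<Sum>k<d. (vu p k)\<^sup>2) \<le> \<nu>u" "sqrt (\<Sum>k<d. \<Sum>l<d. (vw p k l)\<^sup>2) \<le> \<nu>w"
    if "p \<in> space (law0 d)" for p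
    using V that by (auto simp: inV_def)
  have const: "integrable (law0 d) (\<lambda>_. c)" "(\<integral>p. c \<partial>law0 d) = c" for c :: real
    by (simp_all add: law.prob_space)
  have 1: "\<bar>\<integral>p. feat_c sg d T q X p * vc p \<partial>law0 d\<bar> \<le> \<sigma>0 * \<nu>c"
    using \<sigma>_pos by (intro order_trans[OF abs_integral_le_of_dominated[OF const(1)[of "\<sigma>0 * \<nu>c"]]])
      (auto simp: feat_c_def abs_mult law.prob_space intro!: mult_mono sg_bound V')
  have 2: "\<bar>\<integral>p. (\<Sum>k<d. feat_u sg' d T q X p k * vu p k) \<partial>law0 d\<bar> \<le> \<sigma>1 * \<nu>u"
  proof (rule order_trans[OF abs_integral_le_of_dominated[OF const(1)[of "\<sigma>1 * \<nu>u"]]])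
    fix p assume p: "p \<in> space (law0 d)"
    have "(\<Sum>k<d. feat_u sg' d T q X p k * vu p k) = sg' (preact d T q X (nU p) (nW p)) *
       smavg T (scores d X (nW p) (q X)) (uproj d X (vu p))"
      unfolding sum_attn_mult[symmetric] by (simp add: feat_u_def sum_distrib_left mult.assoc)
    moreover have "\<bar>smavg T (scores d X (nW p) (q X)) (uproj d X (vu p))\<bar> \<le> \<nu>u"
      using V'(2)[OF p] by (intro abs_smavg_le T order_trans[OF abs_uproj_le[OF X]])
    ultimately show "\<bar>\<Sum>k<d. feat_u sg' d T q X p k * vu p k\<bar> \<le> \<sigma>1 * \<nu>u"
      using \<sigma>_pos by (auto simp: abs_mult intro!: mult_mono sg_bound)
  qed (simp add: law.prob_space)
  define g where "g p = ((\<Sum>k<d. (p (Nu k))\<^sup>2) + real d) / (2 * sqrt (real d))" for p :: "ncoord \<Rightarrow> real"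
  have g: "integrable (law0 d) g" "integral\<^sup>L (law0 d) g = sqrt (real d)"
    using integrable_normU_dominator[OF d] by (auto simp: g_def[abs_def] has_bochner_integral_iff)
  have 3: "\<bar>\<integral>p. (\<Sum>k<d. \<Sum>l<d. feat_w sg' d T q X p k l * vw p k l) \<partial>law0 d\<bar>
      \<le> (\<integral>p. \<sigma>1 * (2 * \<nu>w) * g p \<partial>law0 d)"
  proof (rule abs_integral_le_of_dominated)
    fix p assume p: "p \<in> space (law0 d)"
    \<comment> \<open>The W feature is the rank-one matrix (M U) q^T, so pairing it with
      \<open>vw\<close> equals pairing M U with \<open>vw\<close> q, whose token values are the
      scores of \<open>vw\<close>.\<close>
    have s: "uproj d X (\<lambda>k. \<Sum>l<d. vw p k l * q X l) = scores d X (vw p) (q X)"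
      by (simp add: fun_eq_iff uproj_def scores_def mult.commute)
    have "(\<Sum>k<d. \<Sum>l<d. feat_w sg' d T q X p k l * vw p k l) =
      sg' (preact d T q X (nU p) (nW p)) *
      (\<Sum>k<d. (\<Sum>k'<d. Mmat d T q X (nW p) k k' * nU p k') * (\<Sum>l<d. vw p k l * q X l))"
      unfolding feat_w_def sum_distrib_left[of "sg' _"] sum_distrib_left[of _ _ "{..<d}"]
      by (simp add: mult_ac sum_distrib_left sum_distrib_right)
    also have "\<dots> = sg' (preact d T q X (nU p) (nW p)) *
       smcov T (scores d X (nW p) (q X)) (scores d X (vw p) (q X)) (uproj d X (nU p))"
      unfolding sum_Mmat_mult s ..
    also have "\<bar>\<dots>\<bar> \<le> \<sigma>1 * (2 * \<nu>w * normU d p)"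
      unfolding abs_mult using \<sigma>_pos V'(3)[OF p]
      by (intro mult_mono sg_bound abs_smcov_le T uproj_le[OF X] order_trans[OF abs_scores_le[OF X _ q[OF X]]]) auto
    also have "\<dots> \<le> \<sigma>1 * (2 * \<nu>w * g p)"
      using \<sigma>_pos \<nu> normU_le_dominator[OF d, of p] by (intro mult_left_mono) (auto simp: g_def)
    finally show "\<bar>\<Sum>k<d. \<Sum>l<d. feat_w sg' d T q X p k l * vw p k l\<bar> \<le> \<sigma>1 * (2 * \<nu>w) * g p"
      by (simp add: mult.assoc)
  qed (simp add: g)
  have "\<sigma>1 * sqrt (real d) \<le> L\<^sub>1"
    using sqrt_d_le_B \<sigma>_pos L1_bounds(2) by (meson less_imp_le mult_left_mono order_trans)
  then have a: "2 * \<nu>w * (\<sigma>1 * sqrt (real d)) \<le> 2 * \<nu>w * L\<^sub>1" using \<nu> by (intro mult_left_mono) auto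
  have b: "\<nu>u * \<sigma>1 \<le> \<nu>u * L\<^sub>1" using \<nu> L1_bounds by (intro mult_left_mono) auto
  have c: "\<sigma>0 * \<nu>c / \<sigma>1 * \<sigma>1 \<le> \<sigma>0 * \<nu>c / \<sigma>1 * L\<^sub>1"
    using \<nu> \<sigma>_pos by (intro mult_left_mono L1_bounds) auto
  have "\<bar>ftilde sg sg' d T q vc vu vw X\<bar> \<le> \<sigma>0 * \<nu>c + \<sigma>1 * \<nu>u + \<sigma>1 * (2 * \<nu>w) * sqrt (real d)"
    unfolding ftilde_def using 1 2 3 by (simp add: g)
  then show ?thesis using a b c \<sigma>_pos by (simp add: algebra_simps)
qed

lemma transported_in_Omega:
  assumes V: "inV d \<nu>c \<nu>u \<nu>w vc vu vw"
    and le: "\<nu>c \<le> \<rho>c" "\<nu>u \<le> \<rho>u" "\<nu>w \<le> \<rho>w"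
  shows "transported m d vc vu vw phi0 \<in> \<Omega>"
  unfolding Omega_iff
proof (intro conjI allI impI)
  show "valid m d (transported m d vc vu vw phi0)" by (auto simp: valid_def transported_def)
next
  fix i assume i: "i < m"
  \<comment> \<open>The bounds in \<open>inV\<close> are stated on the space of \<open>law0\<close>,
    which consists of functions extensional on \<open>ncoords d\<close>; the restriction places the
    realized weights there.\<close>
  define p where "p = restrict (phi0 i) (ncoords d)"
  have p: "p \<in> space (law0 d)" by (auto simp: space_law0 p_def)
  have V': "\<bar>vc p\<bar> \<le> \<nu>c" "sqrt (\<Sum>k<d. (vu p k)\<^sup>2) \<le> \<nu>u" "sqrt (\<Sum>k<d. \<Sum>l<d. (vw p k l)\<^sup>2) \<le> \<nu>w"
    using V p by (auto simp: inV_def)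
  \<comment> \<open>The sign in front of the transport directions disappears after squaring.\<close>
  have c: "(phi0 i Nc)\<^sup>2 = 1" using init_Nc[OF i] by (metis one_power2 power2_abs)
  show "\<bar>transported m d vc vu vw phi0 i Nc - phi0 i Nc\<bar> \<le> \<rho>c / sqrt (real m)"
    using i V' le sqrt_m by (simp add: transported_def p_def[symmetric] divide_right_mono)
  have "normU d (\<lambda>\<kappa>. transported m d vc vu vw phi0 i \<kappa> - phi0 i \<kappa>)
      = sqrt (\<Sum>k<d. (vu p k)\<^sup>2 / real m)"
    using i by (simp add: normU_def transported_def p_def[symmetric] power_divide power_mult_distrib c)
  also have "\<dots> = sqrt (\<Sum>k<d. (vu p k)\<^sup>2) / sqrt (real m)"
    by (simp add: real_sqrt_divide flip: sum_divide_distrib)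
  also have "\<dots> \<le> \<rho>u / sqrt (real m)" using V' le by (intro divide_right_mono) auto
  finally show "normU d (\<lambda>\<kappa>. transported m d vc vu vw phi0 i \<kappa> - phi0 i \<kappa>) \<le> \<rho>u / sqrt (real m)" .
  have "normW d (\<lambda>\<kappa>. transported m d vc vu vw phi0 i \<kappa> - phi0 i \<kappa>)
      = sqrt (\<Sum>k<d. \<Sum>l<d. (vw p k l)\<^sup>2 / real m)"
    using i by (simp add: normW_def transported_def p_def[symmetric] power_divide power_mult_distrib c)
  also have "\<dots> = sqrt (\<Sum>k<d. \<Sum>l<d. (vw p k l)\<^sup>2) / sqrt (real m)"
    by (simp add: real_sqrt_divide flip: sum_divide_distrib)
  also have "\<dots> \<le> \<rho>w / sqrt (real m)" using V' le by (intro divide_right_mono) auto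
  finally show "normW d (\<lambda>\<kappa>. transported m d vc vu vw phi0 i \<kappa> - phi0 i \<kappa>) \<le> \<rho>w / sqrt (real m)" .
qed

end


subsection \<open>Projected gradient descent\<close>

lemma telescoping_bound:
  fixes D a :: "nat \<Rightarrow> real"
  assumes "\<And>s. D (Suc s) + a s \<le> D s + b"
  shows "D N + (\<Sum>s<N. a s) \<le> D 0 + real N * b"
proof (induction N)
  case (Suc N)
  then show ?case using assms[of N] by (simp add: algebra_simps)
qed simp

lemma net_dir_add: "net_dir sg sg' d T m q X phi (\<lambda>i \<kappa>. v i \<kappa> + w i \<kappa>)
    = net_dir sg sg' d T m q X phi v + net_dir sg sg' d T m q X phi w"
  unfolding net_dir_def neuron_dir_add by (simp add: sum.distrib algebra_simps)

lemma net_dir_scale: "net_dir sg sg' d T m q X phi (\<lambda>i \<kappa>. c * v i \<kappa>) = c * net_dir sg sg' d T m q X phi v"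
  unfolding net_dir_def neuron_dir_scale by (simp add: sum_distrib_left mult_ac)

lemma net_dir_sum:
  "net_dir sg sg' d T m q X phi (\<lambda>i \<kappa>. \<Sum>s<(N::nat). v s i \<kappa>) = (\<Sum>s<N. net_dir sg sg' d T m q X phi (v s))"
proof (induction N)
  case 0
  show ?case using net_dir_scale[of sg sg' d T m q X phi 0 "\<lambda>_ _. 0"] by simp
next
  case (Suc N)
  then show ?case by (simp add: net_dir_add)
qed

lemma square_average_le:
  fixes a :: "nat \<Rightarrow> real"
  assumes "\<tau> \<ge> 1"
  shows "((1 / real \<tau>) * (\<Sum>s<\<tau>. a s))\<^sup>2 \<le> (1 / real \<tau>) * (\<Sum>s<\<tau>. (a s)\<^sup>2)"
proof -
  have "(\<Sum>s<\<tau>. a s)\<^sup>2 \<le> real \<tau> * (\<Sum>s<\<tau>. (a s)\<^sup>2)"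
    using Cauchy_Schwarz_ineq_sum[of "\<lambda>_. 1" a "{..<\<tau>}"] by simp
  then have "(\<Sum>s<\<tau>. a s)\<^sup>2 / (real \<tau>)\<^sup>2 \<le> real \<tau> * (\<Sum>s<\<tau>. (a s)\<^sup>2) / (real \<tau>)\<^sup>2"
    by (rule divide_right_mono) simp
  then show ?thesis using assms by (simp add: power_divide power2_eq_square)
qed

lemma square_add_le: "(a + b)\<^sup>2 \<le> 2 * a\<^sup>2 + 2 * (b::real)\<^sup>2"
  using zero_le_power2[of "a - b"] by (simp add: power2_eq_square algebra_simps)

lemma flin_eq_net_dir:
  assumes "T \<ge> 1" "\<And>u. (sg has_real_derivative sg' u) (at u)"
  shows "flin sg d T m q X phi0 phi = fnet sg d T m q X phi0
    + net_dir sg sg' d T m q X phi0 (\<lambda>i \<kappa>. phi i \<kappa> - phi0 i \<kappa>)"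
  unfolding flin_def sum_ppartial_fnet[OF assms] ..

text \<open>The descent argument needs only a comparison point in Omega whose linearized output fits
  the labels up to a number, here called \<open>B_app\<close> and shadowing the constant of that
  name. The transported parameters are substituted at the end.\<close>

locale attention_pgd = attention_net +
  fixes n \<tau> :: nat and Xs :: "nat \<Rightarrow> mat" and ys :: "nat \<Rightarrow> real" and phi :: "nat \<Rightarrow> param"
    and target :: param and K_y B_app :: real
  assumes n: "n \<ge> 1" and \<tau>: "\<tau> \<ge> 1"
    and Xs: "\<And>j. j < n \<Longrightarrow> inX d T (Xs j)"
    and phi_0: "phi 0 = phi0"
    and phi_Suc: "\<And>s. phi (Suc s) = proj m d \<Omega>
          (\<lambda>i \<kappa>. phi s i \<kappa> - (1 / sqrt (real \<tau>)) * pgrad m d (loss sg d T m q n Xs ys) (phi s) i \<kappa>)"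
    and target: "target \<in> \<Omega>"
    and K_y: "0 \<le> K_y" "\<And>j. j < n \<Longrightarrow> \<bar>ys j\<bar> \<le> K_y * L\<^sub>1"
    and B_app: "\<And>j. j < n \<Longrightarrow> \<bar>flin sg d T m q (Xs j) phi0 target - ys j\<bar> \<le> B_app"
begin

abbreviation "Lhat \<equiv> loss sg d T m q n Xs ys"
definition "K_res = K_grad * sqrt (\<rho>c\<^sup>2 + \<rho>u\<^sup>2 + \<rho>w\<^sup>2) + K_y"
definition "E_lin = K_lin * (L\<^sub>1 + L\<^sub>2) / sqrt (real m)"

lemma K_res_nonneg: "0 \<le> K_res"
  using K_pos K_y by (simp add: K_res_def)

lemma E_lin_nonneg: "0 \<le> E_lin"
  using K_pos L1_bounds by (simp add: E_lin_def)

lemma B_app_nonneg: "0 \<le> B_app"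
  using B_app[of 0] n by linarith

lemma phi_in_Omega: "phi s \<in> \<Omega>"
  by (cases s) (simp_all add: phi_0 phi0_in_Omega phi_Suc proj_Omega(1)[OF phi0_in_Omega])

lemma residual_le:
  assumes "psi \<in> \<Omega>" "j < n"
  shows "\<bar>net (Xs j) psi - ys j\<bar> \<le> K_res * L\<^sub>1"
  using net_diff_le[OF Xs[OF assms(2)] assms(1)] K_y(2)[OF assms(2)]
  by (simp add: K_res_def algebra_simps)

lemma mean_le:
  assumes "\<And>j. j < n \<Longrightarrow> a j \<le> b j + c"
  shows "(2 / real n) * (\<Sum>j<n. a j) \<le> (2 / real n) * (\<Sum>j<n. b j) + 2 * c"
proof -
  have "(\<Sum>j<n. a j) \<le> (\<Sum>j<n. b j + c)" using assms by (intro sum_mono) auto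
  also have "\<dots> = (\<Sum>j<n. b j) + real n * c" by (simp add: sum.distrib)
  finally have "(2 / real n) * (\<Sum>j<n. a j) \<le> (2 / real n) * ((\<Sum>j<n. b j) + real n * c)"
    by (intro mult_left_mono) auto
  then show ?thesis using n by (simp add: field_simps)
qed

text \<open>Pairing the gradient with itself bounds the squared norm by a constant times the norm,
  and one factor is cancelled.\<close>

lemma gradient_norm_le: "pnorm m d (pgrad m d Lhat (phi s)) \<le> 2 * K_res * K_grad * L\<^sub>1\<^sup>2"
proof -
  define g where "g = pgrad m d Lhat (phi s)"
  define N where "N = pnorm m d g"
  have "N\<^sup>2 = (\<Sum>i<m. \<Sum>\<kappa>\<in>ncoords d. g i \<kappa> * g i \<kappa>)"
    by (simp add: N_def pnorm_def sum_nonneg power2_eq_square)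
  also have "\<dots> = (2 / real n) * (\<Sum>j<n. (net (Xs j) (phi s) - ys j) * dnet (Xs j) (phi s) g)"
    unfolding g_def by (rule sum_pgrad_loss[OF T sg(1)])
  also have "\<dots> \<le> (2 / real n) * (\<Sum>j<n. 0) + 2 * ((K_res * L\<^sub>1) * (K_grad * L\<^sub>1 * N))"
  proof (rule mean_le)
    fix j assume j: "j < n"
    have "\<bar>(net (Xs j) (phi s) - ys j) * dnet (Xs j) (phi s) g\<bar> \<le> (K_res * L\<^sub>1) * (K_grad * L\<^sub>1 * N)"
      unfolding abs_mult N_def using K_res_nonneg L1_bounds
      by (intro mult_mono residual_le dnet_le Xs phi_in_Omega j) auto
    then show "(net (Xs j) (phi s) - ys j) * dnet (Xs j) (phi s) g \<le> 0 + (K_res * L\<^sub>1) * (K_grad * L\<^sub>1 * N)"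
      by linarith
  qed
  finally have N2: "N * N \<le> (2 * K_res * K_grad * L\<^sub>1\<^sup>2) * N"
    by (simp add: power2_eq_square algebra_simps)
  have "N \<le> 2 * K_res * K_grad * L\<^sub>1\<^sup>2"
  proof (cases "N = 0")
    case True
    then show ?thesis using K_res_nonneg K_pos by simp
  next
    case False
    then have "0 < N" by (simp add: N_def less_le)
    then show ?thesis using N2 by simp
  qed
  then show ?thesis by (simp add: N_def g_def)
qed

text \<open>The directional derivative towards the target is nearly the output at the target minus
  the current output, that is, nearly -r for the residual r. Each sample therefore contributes about
  -r^2, and the defect is multiplied by the bound on r.\<close>

lemma gradient_inner_le:
  "(\<Sum>i<m. \<Sum>\<kappa>\<in>ncoords d. pgrad m d Lhat (phi s) i \<kappa> * (target i \<kappa> - phi s i \<kappa>))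
    \<le> - 2 * Lhat (phi s) + 2 * (K_res * L\<^sub>1 * (B_app + 2 * E_lin))"
proof -
  define v where "v = (\<lambda>i \<kappa>. target i \<kappa> - phi s i \<kappa>)"
  have "(\<Sum>i<m. \<Sum>\<kappa>\<in>ncoords d. pgrad m d Lhat (phi s) i \<kappa> * v i \<kappa>)
     = (2 / real n) * (\<Sum>j<n. (net (Xs j) (phi s) - ys j) * dnet (Xs j) (phi s) v)"
    by (rule sum_pgrad_loss[OF T sg(1)])
  also have "\<dots> \<le> (2 / real n) * (\<Sum>j<n. - (net (Xs j) (phi s) - ys j)\<^sup>2) + 2 * (K_res * L\<^sub>1 * (B_app + 2 * E_lin))"
  proof (rule mean_le)
    fix j assume j: "j < n"
    define r where "r = net (Xs j) (phi s) - ys j"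
    \<comment> \<open>The defect has three parts: linearization at the iterate, linearization at the
      initialization (to pass from the network at the target to \<open>flin\<close>), and the label
      fit \<open>B_app\<close>.\<close>
    define e where "e = dnet (Xs j) (phi s) v + r"
    have 1: "\<bar>net (Xs j) target - net (Xs j) (phi s) - dnet (Xs j) (phi s) v\<bar> \<le> E_lin"
      unfolding v_def E_lin_def by (intro linearization_error Xs j target phi_in_Omega)
    have 2: "\<bar>net (Xs j) target - flin sg d T m q (Xs j) phi0 target\<bar> \<le> E_lin"
      using linearization_error[OF Xs[OF j] phi0_in_Omega target]
      by (simp add: flin_eq_net_dir[OF T sg(1)] E_lin_def algebra_simps)
    have "\<bar>e\<bar> \<le> B_app + 2 * E_lin"
      using 1 2 B_app[OF j] unfolding e_def r_def by linarith
    then have "\<bar>r * e\<bar> \<le> K_res * L\<^sub>1 * (B_app + 2 * E_lin)"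
      unfolding abs_mult r_def using K_res_nonneg L1_bounds j
      by (intro mult_mono residual_le phi_in_Omega) auto
    moreover have "r * dnet (Xs j) (phi s) v = - r\<^sup>2 + r * e"
      by (simp add: e_def power2_eq_square algebra_simps)
    ultimately show "(net (Xs j) (phi s) - ys j) * dnet (Xs j) (phi s) v
      \<le> - (net (Xs j) (phi s) - ys j)\<^sup>2 + K_res * L\<^sub>1 * (B_app + 2 * E_lin)"
      unfolding r_def by linarith
  qed
  also have "(2 / real n) * (\<Sum>j<n. - (net (Xs j) (phi s) - ys j)\<^sup>2) = - 2 * Lhat (phi s)"
    by (simp add: loss_def sum_negf)
  finally show ?thesis by (simp add: v_def)
qed

lemma average_loss_le:
  "(1 / real \<tau>) * (\<Sum>s<\<tau>. Lhat (phi s)) \<le>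
    (\<rho>c\<^sup>2 + \<rho>u\<^sup>2 + \<rho>w\<^sup>2 + (2 * K_res * K_grad * L\<^sub>1\<^sup>2)\<^sup>2) / (4 * sqrt (real \<tau>)) + K_res * L\<^sub>1 * (B_app + 2 * E_lin)"
proof -
  define \<eta> where "\<eta> = 1 / sqrt (real \<tau>)"
  define G where "G = 2 * K_res * K_grad * L\<^sub>1\<^sup>2"
  define F where "F = K_res * L\<^sub>1 * (B_app + 2 * E_lin)"
  define D where "D s = pdist2 m d (phi s) target" for s
  have \<eta>: "0 < \<eta>" using \<tau> by (simp add: \<eta>_def)
  have step: "D (Suc s) + 4 * \<eta> * Lhat (phi s) \<le> D s + (4 * \<eta> * F + \<eta>\<^sup>2 * G\<^sup>2)" for s
  proof -
    define g where "g = pgrad m d Lhat (phi s)"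
    have "D (Suc s) \<le> pdist2 m d (\<lambda>i \<kappa>. phi s i \<kappa> - \<eta> * g i \<kappa>) target"
      unfolding D_def phi_Suc \<eta>_def g_def by (rule proj_Omega_contracts[OF target])
    also have "\<dots> = D s - 2 * \<eta> * (\<Sum>i<m. \<Sum>\<kappa>\<in>ncoords d. (phi s i \<kappa> - target i \<kappa>) * g i \<kappa>) + \<eta>\<^sup>2 * (pnorm m d g)\<^sup>2"
      using pdist2_expand[of m d "phi s" "- \<eta>" g target] by (simp add: D_def)
    also have "(\<Sum>i<m. \<Sum>\<kappa>\<in>ncoords d. (phi s i \<kappa> - target i \<kappa>) * g i \<kappa>)
        = - (\<Sum>i<m. \<Sum>\<kappa>\<in>ncoords d. g i \<kappa> * (target i \<kappa> - phi s i \<kappa>))"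
      unfolding sum_negf[symmetric] by (intro sum.cong refl) (simp add: algebra_simps)
    also have "D s - 2 * \<eta> * - (\<Sum>i<m. \<Sum>\<kappa>\<in>ncoords d. g i \<kappa> * (target i \<kappa> - phi s i \<kappa>)) + \<eta>\<^sup>2 * (pnorm m d g)\<^sup>2
       \<le> D s - 2 * \<eta> * - (- 2 * Lhat (phi s) + 2 * F) + \<eta>\<^sup>2 * G\<^sup>2"
      using gradient_inner_le[of s] \<eta> gradient_norm_le[of s]
      by (intro add_mono diff_mono mult_left_mono power_mono) (auto simp: g_def G_def F_def)
    finally show ?thesis by (simp add: algebra_simps)
  qed
  have "0 \<le> D \<tau>" by (simp add: D_def pdist2_def sum_nonneg)
  moreover have "D 0 \<le> \<rho>c\<^sup>2 + \<rho>u\<^sup>2 + \<rho>w\<^sup>2"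
    using pnorm_Omega[OF target]
    by (simp add: D_def phi_0 pdist2_def pnorm_def sum_nonneg power2_commute)
  ultimately have "4 * \<eta> * (\<Sum>s<\<tau>. Lhat (phi s)) \<le> \<rho>c\<^sup>2 + \<rho>u\<^sup>2 + \<rho>w\<^sup>2 + real \<tau> * (4 * \<eta> * F + \<eta>\<^sup>2 * G\<^sup>2)"
    using telescoping_bound[of D "\<lambda>s. 4 * \<eta> * Lhat (phi s)", OF step, of \<tau>]
    by (simp add: sum_distrib_left)
  \<comment> \<open>The step size balances the two terms: \<tau> * \<eta>^2 = 1 keeps the
    accumulated gradient term bounded, while \<tau> * \<eta> = sqrt \<tau>.\<close>
  also have "real \<tau> * (4 * \<eta> * F + \<eta>\<^sup>2 * G\<^sup>2) = 4 * sqrt (real \<tau>) * F + G\<^sup>2"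
    using \<tau> by (simp add: \<eta>_def field_simps power_divide)
  finally have "4 * \<eta> * (\<Sum>s<\<tau>. Lhat (phi s)) / (4 * sqrt (real \<tau>))
     \<le> (\<rho>c\<^sup>2 + \<rho>u\<^sup>2 + \<rho>w\<^sup>2 + (4 * sqrt (real \<tau>) * F + G\<^sup>2)) / (4 * sqrt (real \<tau>))"
    using \<tau> by (intro divide_right_mono) auto
  also have "4 * \<eta> * (\<Sum>s<\<tau>. Lhat (phi s)) / (4 * sqrt (real \<tau>)) = (1 / real \<tau>) * (\<Sum>s<\<tau>. Lhat (phi s))"
    using \<tau> by (simp add: \<eta>_def)
  also have "(\<rho>c\<^sup>2 + \<rho>u\<^sup>2 + \<rho>w\<^sup>2 + (4 * sqrt (real \<tau>) * F + G\<^sup>2)) / (4 * sqrt (real \<tau>))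
     = (\<rho>c\<^sup>2 + \<rho>u\<^sup>2 + \<rho>w\<^sup>2 + G\<^sup>2) / (4 * sqrt (real \<tau>)) + F"
    using \<tau> by (simp add: field_simps)
  finally show ?thesis unfolding G_def F_def .
qed

text \<open>The loss is not convex in the parameters, so Jensen is applied to the linearization at
  the initialization, with one passage to it from the iterates and one back at the average.\<close>

lemma loss_average_iterate_le:
  "Lhat (\<lambda>i \<kappa>. (1 / real \<tau>) * (\<Sum>s<\<tau>. phi s i \<kappa>))
    \<le> 4 * ((1 / real \<tau>) * (\<Sum>s<\<tau>. Lhat (phi s))) + 6 * E_lin\<^sup>2"
proof -
  define avg where "avg = (\<lambda>i \<kappa>. (1 / real \<tau>) * (\<Sum>s<\<tau>. phi s i \<kappa>))"
  have avg: "avg \<in> \<Omega>"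
    using Omega_convex_sum[of "{..<\<tau>}" "\<lambda>_. 1 / real \<tau>" phi, OF _ _ _ phi_in_Omega] \<tau>
    by (simp add: avg_def sum_distrib_left)
  have point: "(net (Xs j) avg - ys j)\<^sup>2 \<le>
      (1 / real \<tau>) * (\<Sum>s<\<tau>. 4 * (net (Xs j) (phi s) - ys j)\<^sup>2) + 6 * E_lin\<^sup>2" if j: "j < n" for j
  proof -
    \<comment> \<open>As the network vanishes at \<open>phi0\<close>, this linear part is itself the
      linearized network, and it is affine in \<open>psi\<close>.\<close>
    define l where "l psi = dnet (Xs j) phi0 (\<lambda>i \<kappa>. psi i \<kappa> - phi0 i \<kappa>)" for psi
    have err: "\<bar>net (Xs j) psi - l psi\<bar> \<le> E_lin" if "psi \<in> \<Omega>" for psi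
      using linearization_error[OF Xs[OF j] phi0_in_Omega that] net_phi0[OF Xs[OF j]]
      by (simp add: l_def E_lin_def)
    then have err2: "(net (Xs j) psi - l psi)\<^sup>2 \<le> E_lin\<^sup>2" if "psi \<in> \<Omega>" for psi
      using that E_lin_nonneg abs_le_square_iff[of "net (Xs j) psi - l psi" E_lin] by simp
    have "(\<lambda>i \<kappa>. avg i \<kappa> - phi0 i \<kappa>) = (\<lambda>i \<kappa>. (1 / real \<tau>) * (\<Sum>s<\<tau>. phi s i \<kappa> - phi0 i \<kappa>))"
      using \<tau> by (simp add: avg_def sum_subtractf fun_eq_iff right_diff_distrib diff_divide_distrib)
    then have "l avg = (1 / real \<tau>) * (\<Sum>s<\<tau>. l (phi s))"
      by (simp only: l_def net_dir_scale net_dir_sum)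
    then have lavg: "l avg - ys j = (1 / real \<tau>) * (\<Sum>s<\<tau>. l (phi s) - ys j)"
      using \<tau> by (simp add: sum_subtractf right_diff_distrib diff_divide_distrib)
    have each: "(l (phi s) - ys j)\<^sup>2 \<le> 2 * (net (Xs j) (phi s) - ys j)\<^sup>2 + 2 * E_lin\<^sup>2" for s
      using square_add_le[of "net (Xs j) (phi s) - ys j" "l (phi s) - net (Xs j) (phi s)"] err2[OF phi_in_Omega, of s]
      by (simp add: power2_commute)
    have "(l avg - ys j)\<^sup>2 \<le> (1 / real \<tau>) * (\<Sum>s<\<tau>. (l (phi s) - ys j)\<^sup>2)"
      unfolding lavg by (rule square_average_le[OF \<tau>])
    also have "\<dots> \<le> (1 / real \<tau>) * (\<Sum>s<\<tau>. 2 * (net (Xs j) (phi s) - ys j)\<^sup>2 + 2 * E_lin\<^sup>2)"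
      by (intro mult_left_mono sum_mono each) auto
    also have "\<dots> = (1 / real \<tau>) * (\<Sum>s<\<tau>. 2 * (net (Xs j) (phi s) - ys j)\<^sup>2) + 2 * E_lin\<^sup>2"
      using \<tau> by (simp add: sum.distrib field_simps)
    finally have 1: "(l avg - ys j)\<^sup>2 \<le> (1 / real \<tau>) * (\<Sum>s<\<tau>. 2 * (net (Xs j) (phi s) - ys j)\<^sup>2) + 2 * E_lin\<^sup>2" .
    have "(net (Xs j) avg - ys j)\<^sup>2 \<le> 2 * (l avg - ys j)\<^sup>2 + 2 * E_lin\<^sup>2"
      using square_add_le[of "l avg - ys j" "net (Xs j) avg - l avg"] err2[OF avg] by simp
    \<comment> \<open>Squaring a sum doubles twice, hence the 4 on the losses; the errors add up to
      2 * 2 + 2 = 6.\<close>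
    then have "(net (Xs j) avg - ys j)\<^sup>2 \<le>
        2 * ((1 / real \<tau>) * (\<Sum>s<\<tau>. 2 * (net (Xs j) (phi s) - ys j)\<^sup>2)) + 6 * E_lin\<^sup>2"
      using 1 by linarith
    then show ?thesis by (simp flip: sum_distrib_left)
  qed
  have "(\<Sum>j<n. (net (Xs j) avg - ys j)\<^sup>2) \<le>
     (\<Sum>j<n. (1 / real \<tau>) * (\<Sum>s<\<tau>. 4 * (net (Xs j) (phi s) - ys j)\<^sup>2) + 6 * E_lin\<^sup>2)"
    using point by (intro sum_mono) auto
  also have "\<dots> = (1 / real \<tau>) * (\<Sum>j<n. \<Sum>s<\<tau>. 4 * (net (Xs j) (phi s) - ys j)\<^sup>2) + real n * (6 * E_lin\<^sup>2)"
    by (simp add: sum.distrib sum_distrib_left)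
  also have "(\<Sum>j<n. \<Sum>s<\<tau>. 4 * (net (Xs j) (phi s) - ys j)\<^sup>2) = (\<Sum>s<\<tau>. 4 * (real n * Lhat (phi s)))"
    using n by (subst sum.swap) (simp add: loss_def sum_distrib_left)
  finally have "(1 / real n) * (\<Sum>j<n. (net (Xs j) avg - ys j)\<^sup>2) \<le>
     (1 / real n) * ((1 / real \<tau>) * (\<Sum>s<\<tau>. 4 * (real n * Lhat (phi s))) + real n * (6 * E_lin\<^sup>2))"
    by (intro mult_left_mono) auto
  also have "\<dots> = 4 * ((1 / real \<tau>) * (\<Sum>s<\<tau>. Lhat (phi s))) + 6 * E_lin\<^sup>2"
    using n by (simp add: field_simps flip: sum_distrib_left)
  finally show ?thesis unfolding avg_def[symmetric] by (simp add: loss_def)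
qed

end

section \<open>Choice of the constant and the final bounds\<close>

lemma Min_image_le_average:
  fixes f :: "nat \<Rightarrow> real"
  assumes "\<tau> \<ge> 1"
  shows "Min (f ` {..<\<tau>}) \<le> (1 / real \<tau>) * (\<Sum>s<\<tau>. f s)"
proof -
  have "(\<Sum>s<\<tau>. Min (f ` {..<\<tau>})) \<le> (\<Sum>s<\<tau>. f s)"
    by (intro sum_mono Min_le) auto
  then show ?thesis using assms by (simp add: field_simps)
qed

text \<open>The locale constants are unfolded at top level because C has to be fixed before
  dimensions, network and data. The factor 4 and the last summand come from the averaged iterate; a
  smaller value would do for the minimum.\<close>

definition pgd_const :: "real \<Rightarrow> real \<Rightarrow> real \<Rightarrow> real \<Rightarrow> real \<Rightarrow> real \<Rightarrow> real" where
  "pgd_const \<sigma>0 \<sigma>1 \<rho>c \<rho>u \<rho>w K_y =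
    (let K_grad = \<sigma>0 / \<sigma>1 + 3 * (1 + \<rho>c); K_step = 2 * (\<rho>u + \<rho>w);
         K_lin = 6 * \<rho>c * K_step + 5 * (1 + \<rho>c) * K_step\<^sup>2;
         R = \<rho>c\<^sup>2 + \<rho>u\<^sup>2 + \<rho>w\<^sup>2; K_res = K_grad * sqrt R + K_y
     in 4 * (R / (4 * \<sigma>1 ^ 4) + K_res\<^sup>2 * K_grad\<^sup>2 + K_res * (1 + 2 * K_lin))
        + 6 * (K_lin / min (\<rho>c * sqrt (\<rho>w\<^sup>2 + \<rho>u\<^sup>2)) (\<rho>w\<^sup>2 + \<rho>u\<^sup>2))\<^sup>2)"

context attention_pgd
begin

abbreviation "Bl \<equiv> B_lin \<sigma>1 \<sigma>2 d m \<rho>c \<rho>u \<rho>w \<delta>'"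

text \<open>\<open>B_lin\<close> weights \<open>L\<^sub>1\<close> and \<open>L\<^sub>2\<close> by
  positive functions of the radii; their minimum c makes it dominate c * (\<open>L\<^sub>1\<close> +
  \<open>L\<^sub>2\<close>) / sqrt m. This converts the squared linearization error into the square
  of \<open>B_lin\<close>.\<close>

lemma E_lin_le_B_lin:
  defines "c \<equiv> min (\<rho>c * sqrt (\<rho>w\<^sup>2 + \<rho>u\<^sup>2)) (\<rho>w\<^sup>2 + \<rho>u\<^sup>2)"
  shows "0 \<le> Bl" "E_lin \<le> K_lin / c * Bl"
proof -
  have c: "0 < c" using \<rho>_pos by (simp add: c_def add_pos_pos)
  have "c * (L\<^sub>1 + L\<^sub>2) \<le> L\<^sub>1 * \<rho>c * sqrt (\<rho>w\<^sup>2 + \<rho>u\<^sup>2) + L\<^sub>2 * (\<rho>w\<^sup>2 + \<rho>u\<^sup>2)"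
  proof -
    have "L\<^sub>1 * c \<le> L\<^sub>1 * (\<rho>c * sqrt (\<rho>w\<^sup>2 + \<rho>u\<^sup>2))" "L\<^sub>2 * c \<le> L\<^sub>2 * (\<rho>w\<^sup>2 + \<rho>u\<^sup>2)"
      using L1_bounds by (auto simp: c_def intro!: mult_left_mono)
    then show ?thesis by (simp add: algebra_simps)
  qed
  then have Bl: "c * (L\<^sub>1 + L\<^sub>2) / sqrt (real m) \<le> Bl"
    using sqrt_m by (simp add: B_lin_def divide_right_mono)
  have "0 \<le> c * (L\<^sub>1 + L\<^sub>2) / sqrt (real m)" using c L1_bounds by simp
  then show "0 \<le> Bl" using Bl by linarith
  have "E_lin = K_lin / c * (c * (L\<^sub>1 + L\<^sub>2) / sqrt (real m))"
    using c by (simp add: E_lin_def)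
  also have "\<dots> \<le> K_lin / c * Bl" using Bl c K_pos by (intro mult_left_mono) auto
  finally show "E_lin \<le> K_lin / c * Bl" .
qed

lemma pgd_bounds:
  assumes C: "pgd_const \<sigma>0 \<sigma>1 \<rho>c \<rho>u \<rho>w K_y \<le> C"
  shows "Min ((\<lambda>s. Lhat (phi s)) ` {..<\<tau>})
      \<le> C * (L\<^sub>1 ^ 4 / sqrt (real \<tau>) + L\<^sub>1 * (B_app + Bl + (L\<^sub>1 + L\<^sub>2) / sqrt (real m)))"
    and "Lhat (\<lambda>i \<kappa>. (1 / real \<tau>) * (\<Sum>s<\<tau>. phi s i \<kappa>))
      \<le> C * (L\<^sub>1 ^ 4 / sqrt (real \<tau>) + L\<^sub>1 * (B_app + Bl + (L\<^sub>1 + L\<^sub>2) / sqrt (real m)) + Bl\<^sup>2)"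
proof -
  define R where "R = \<rho>c\<^sup>2 + \<rho>u\<^sup>2 + \<rho>w\<^sup>2"
  define c where "c = min (\<rho>c * sqrt (\<rho>w\<^sup>2 + \<rho>u\<^sup>2)) (\<rho>w\<^sup>2 + \<rho>u\<^sup>2)"
  define A1 where "A1 = R / (4 * \<sigma>1 ^ 4) + K_res\<^sup>2 * K_grad\<^sup>2"
  define A2 where "A2 = K_res * (1 + 2 * K_lin)"
  define A3 where "A3 = 6 * (K_lin / c)\<^sup>2"
  define P where "P = L\<^sub>1 ^ 4 / sqrt (real \<tau>)"
  define Q where "Q = L\<^sub>1 * (B_app + Bl + (L\<^sub>1 + L\<^sub>2) / sqrt (real m))"
  define avgL where "avgL = (1 / real \<tau>) * (\<Sum>s<\<tau>. Lhat (phi s))"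
  note Bl = E_lin_le_B_lin[folded c_def]
  have const: "pgd_const \<sigma>0 \<sigma>1 \<rho>c \<rho>u \<rho>w K_y = 4 * (A1 + A2) + A3"
    by (simp only: pgd_const_def Let_def A1_def A2_def A3_def R_def c_def K_res_def K_grad_def K_lin_def K_step_def)
  have R: "0 \<le> R" by (simp add: R_def)
  have A: "0 \<le> A1" "0 \<le> A2" "0 \<le> A3"
    using R \<sigma>_pos K_res_nonneg K_pos by (auto simp: A1_def A2_def A3_def)
  have frac: "0 \<le> (L\<^sub>1 + L\<^sub>2) / sqrt (real m)" using L1_bounds by simp
  have PQ: "0 \<le> P" "0 \<le> Q"
    using L1_bounds B_app_nonneg Bl(1) frac by (auto simp: P_def Q_def)
  \<comment> \<open>The initial squared distance R has no factor \<open>L\<^sub>1\<close>; it is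
    paid for by \<open>\<sigma>1 ^ 4 \<le> L\<^sub>1 ^ 4\<close>.\<close>
  have "(R + (2 * K_res * K_grad * L\<^sub>1\<^sup>2)\<^sup>2) / (4 * sqrt (real \<tau>)) \<le> A1 * P"
  proof -
    have "\<sigma>1 ^ 4 \<le> L\<^sub>1 ^ 4" using \<sigma>_pos L1_bounds by (intro power_mono) auto
    then have "R / \<sigma>1 ^ 4 * \<sigma>1 ^ 4 \<le> R / \<sigma>1 ^ 4 * L\<^sub>1 ^ 4"
      using R \<sigma>_pos by (intro mult_left_mono) auto
    then have "R \<le> R / \<sigma>1 ^ 4 * L\<^sub>1 ^ 4" using \<sigma>_pos by simp
    then have "R + (2 * K_res * K_grad * L\<^sub>1\<^sup>2)\<^sup>2 \<le> R / \<sigma>1 ^ 4 * L\<^sub>1 ^ 4 + 4 * (K_res\<^sup>2 * K_grad\<^sup>2 * L\<^sub>1 ^ 4)"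
      by (simp add: power_mult_distrib flip: power_mult)
    also have "\<dots> = A1 * L\<^sub>1 ^ 4 * 4" by (simp add: A1_def algebra_simps)
    finally have "(R + (2 * K_res * K_grad * L\<^sub>1\<^sup>2)\<^sup>2) / (4 * sqrt (real \<tau>)) \<le> A1 * L\<^sub>1 ^ 4 * 4 / (4 * sqrt (real \<tau>))"
      by (rule divide_right_mono) simp
    then show ?thesis by (simp add: P_def)
  qed
  moreover have "K_res * L\<^sub>1 * (B_app + 2 * E_lin) \<le> A2 * Q"
  proof -
    have "B_app + 2 * E_lin \<le> (1 + 2 * K_lin) * (B_app + Bl + (L\<^sub>1 + L\<^sub>2) / sqrt (real m))"
    proof -
      have "0 \<le> K_lin * B_app" "0 \<le> K_lin * Bl" using K_pos B_app_nonneg Bl(1) by auto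
      then show ?thesis using Bl(1) frac by (simp add: E_lin_def algebra_simps add_divide_distrib)
    qed
    then have "K_res * L\<^sub>1 * (B_app + 2 * E_lin)
        \<le> K_res * L\<^sub>1 * ((1 + 2 * K_lin) * (B_app + Bl + (L\<^sub>1 + L\<^sub>2) / sqrt (real m)))"
      using K_res_nonneg L1_bounds by (intro mult_left_mono) auto
    then show ?thesis by (simp only: A2_def Q_def mult_ac)
  qed
  ultimately have "avgL \<le> A1 * P + A2 * Q"
    using average_loss_le unfolding avgL_def R_def by linarith
  moreover have "0 \<le> A1 * Q" "0 \<le> A2 * P" using A PQ by auto
  ultimately have avgL: "avgL \<le> (A1 + A2) * (P + Q)"
    by (simp add: algebra_simps)
  have "Min ((\<lambda>s. Lhat (phi s)) ` {..<\<tau>}) \<le> avgL"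
    unfolding avgL_def by (rule Min_image_le_average[OF \<tau>])
  also have "\<dots> \<le> C * (P + Q)"
    using A C const PQ by (intro order_trans[OF avgL] mult_right_mono) auto
  finally show "Min ((\<lambda>s. Lhat (phi s)) ` {..<\<tau>})
      \<le> C * (L\<^sub>1 ^ 4 / sqrt (real \<tau>) + L\<^sub>1 * (B_app + Bl + (L\<^sub>1 + L\<^sub>2) / sqrt (real m)))"
    by (simp add: P_def Q_def)
  have "E_lin\<^sup>2 \<le> (K_lin / c * Bl)\<^sup>2" using Bl(2) E_lin_nonneg by (intro power_mono)
  then have E: "6 * E_lin\<^sup>2 \<le> A3 * Bl\<^sup>2" unfolding A3_def power_mult_distrib by simp
  have "Lhat (\<lambda>i \<kappa>. (1 / real \<tau>) * (\<Sum>s<\<tau>. phi s i \<kappa>)) \<le> 4 * avgL + 6 * E_lin\<^sup>2"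
    unfolding avgL_def by (rule loss_average_iterate_le)
  also have "\<dots> \<le> 4 * ((A1 + A2) * (P + Q)) + A3 * Bl\<^sup>2" using avgL E by linarith
  also have "\<dots> = 4 * (A1 + A2) * (P + Q) + A3 * Bl\<^sup>2" by simp
  also have "\<dots> \<le> C * (P + Q) + C * Bl\<^sup>2"
    using A C const PQ by (intro add_mono mult_right_mono) auto
  also have "\<dots> = C * (P + Q + Bl\<^sup>2)" by (simp add: algebra_simps)
  finally show "Lhat (\<lambda>i \<kappa>. (1 / real \<tau>) * (\<Sum>s<\<tau>. phi s i \<kappa>))
      \<le> C * (L\<^sub>1 ^ 4 / sqrt (real \<tau>) + L\<^sub>1 * (B_app + Bl + (L\<^sub>1 + L\<^sub>2) / sqrt (real m)) + Bl\<^sup>2)"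
    by (simp add: P_def Q_def)
qed

end

theorem theorem1:
  fixes \<sigma>0 \<sigma>1 \<sigma>2 \<nu>c \<nu>u \<nu>w \<rho>c \<rho>u \<rho>w :: real
  assumes "\<sigma>0 > 0" "\<sigma>1 > 0" "\<sigma>2 > 0"
    and "\<nu>c > 0" "\<nu>u > 0" "\<nu>w > 0"
    and "\<rho>c \<ge> \<nu>c" "\<rho>u \<ge> \<nu>u" "\<rho>w \<ge> \<nu>w"
  shows "\<exists>C>0. \<forall>(d::nat) (T::nat) (m::nat) (n::nat) (\<tau>::nat)
      (sg::real \<Rightarrow> real) (sg'::real \<Rightarrow> real) (sg''::real \<Rightarrow> real)
      (q::mat \<Rightarrow> nat \<Rightarrow> real) (Xs::nat \<Rightarrow> mat)
      (vc::(ncoord \<Rightarrow> real) \<Rightarrow> real) (vu::(ncoord \<Rightarrow> real) \<Rightarrow> nat \<Rightarrow> real)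
      (vw::(ncoord \<Rightarrow> real) \<Rightarrow> mat)
      (\<delta>::real) (\<delta>'::real) (phi::nat \<Rightarrow> param).
    d \<ge> 1 \<longrightarrow> T \<ge> 1 \<longrightarrow> m \<ge> 1 \<longrightarrow> even m \<longrightarrow> n \<ge> 1 \<longrightarrow> \<tau> \<ge> 1 \<longrightarrow>
    (\<forall>u. (sg has_real_derivative sg' u) (at u) \<and> (sg' has_real_derivative sg'' u) (at u)) \<longrightarrow>
    (\<forall>u. \<bar>sg u\<bar> \<le> \<sigma>0 \<and> \<bar>sg' u\<bar> \<le> \<sigma>1 \<and> \<bar>sg'' u\<bar> \<le> \<sigma>2) \<longrightarrow>
    (\<forall>X. inX d T X \<longrightarrow> sqrt (\<Sum>k<d. (q X k)^2) \<le> 1) \<longrightarrow>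
    (\<forall>j<n. inX d T (Xs j)) \<longrightarrow>
    inV d \<nu>c \<nu>u \<nu>w vc vu vw \<longrightarrow>
    0 < \<delta> \<longrightarrow> \<delta> < 1 \<longrightarrow> 0 < \<delta>' \<longrightarrow> \<delta>' < 1 \<longrightarrow>
    sym_init m d (phi 0) \<longrightarrow>
    (\<forall>s. phi (Suc s) = proj m d (Omega m d \<rho>c \<rho>u \<rho>w (phi 0))
          (\<lambda>i \<kappa>. phi s i \<kappa> - (1 / sqrt (real \<tau>)) *
             pgrad m d (loss sg d T m q n Xs (\<lambda>j. ftilde sg sg' d T q vc vu vw (Xs j))) (phi s) i \<kappa>)) \<longrightarrow>
    event_U d m \<delta>' (phi 0) \<longrightarrow>
    (\<forall>j<n. \<bar>flin sg d T m q (Xs j) (phi 0) (transported m d vc vu vw (phi 0))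
             - ftilde sg sg' d T q vc vu vw (Xs j)\<bar> \<le> B_app \<sigma>0 \<sigma>1 \<nu>c \<nu>u \<nu>w n m \<delta>) \<longrightarrow>
    (let L1v = L1 \<sigma>1 d m \<rho>u \<delta>'; L2v = L2 \<sigma>1 \<sigma>2 d m \<rho>u \<delta>';
         Bl = B_lin \<sigma>1 \<sigma>2 d m \<rho>c \<rho>u \<rho>w \<delta>'; Ba = B_app \<sigma>0 \<sigma>1 \<nu>c \<nu>u \<nu>w n m \<delta>;
         Lhat = loss sg d T m q n Xs (\<lambda>j. ftilde sg sg' d T q vc vu vw (Xs j))
     in (Min ((\<lambda>s. Lhat (phi s)) ` {..<\<tau>})
           \<le> C * (L1v^4 / sqrt (real \<tau>) + L1v * (Ba + Bl + (L1v + L2v) / sqrt (real m))))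
      \<and> (Lhat (\<lambda>i \<kappa>. (1 / real \<tau>) * (\<Sum>s<\<tau>. phi s i \<kappa>))
           \<le> C * (L1v^4 / sqrt (real \<tau>) + L1v * (Ba + Bl + (L1v + L2v) / sqrt (real m)) + Bl^2)))"
proof (intro exI[of _ "max 1 (pgd_const \<sigma>0 \<sigma>1 \<rho>c \<rho>u \<rho>w (\<sigma>0 * \<nu>c / \<sigma>1 + \<nu>u + 2 * \<nu>w))"] conjI allI impI)
  \<comment> \<open>The label constant of \<open>ftilde_le\<close>, through which the dependence on
    \<nu> enters C. The maximum with 1 secures positivity.\<close>
  let ?K_y = "\<sigma>0 * \<nu>c / \<sigma>1 + \<nu>u + 2 * \<nu>w"
  show "0 < max 1 (pgd_const \<sigma>0 \<sigma>1 \<rho>c \<rho>u \<rho>w ?K_y)" by simp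
  fix d T m n \<tau> :: nat and sg sg' sg'' :: "real \<Rightarrow> real" and q :: "mat \<Rightarrow> nat \<Rightarrow> real" and Xs :: "nat \<Rightarrow> mat"
    and vc :: "(ncoord \<Rightarrow> real) \<Rightarrow> real" and vu :: "(ncoord \<Rightarrow> real) \<Rightarrow> nat \<Rightarrow> real"
    and vw :: "(ncoord \<Rightarrow> real) \<Rightarrow> mat" and \<delta> \<delta>' :: real and phi :: "nat \<Rightarrow> param"
  define ys where "ys = (\<lambda>j. ftilde sg sg' d T q vc vu vw (Xs j))"
  assume H: "1 \<le> d" "1 \<le> T" "1 \<le> m" "even m" "1 \<le> n" "1 \<le> \<tau>"
    "\<forall>u. (sg has_real_derivative sg' u) (at u) \<and> (sg' has_real_derivative sg'' u) (at u)"
    "\<forall>u. \<bar>sg u\<bar> \<le> \<sigma>0 \<and> \<bar>sg' u\<bar> \<le> \<sigma>1 \<and> \<bar>sg'' u\<bar> \<le> \<sigma>2"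
    "\<forall>X. inX d T X \<longrightarrow> sqrt (\<Sum>k<d. (q X k)\<^sup>2) \<le> 1"
    "\<forall>j<n. inX d T (Xs j)" "inV d \<nu>c \<nu>u \<nu>w vc vu vw"
    "0 < \<delta>" "\<delta> < 1" "0 < \<delta>'" "\<delta>' < 1" "sym_init m d (phi 0)"
    and pgd: "\<forall>s. phi (Suc s) = proj m d (Omega m d \<rho>c \<rho>u \<rho>w (phi 0))
          (\<lambda>i \<kappa>. phi s i \<kappa> - (1 / sqrt (real \<tau>)) *
             pgrad m d (loss sg d T m q n Xs (\<lambda>j. ftilde sg sg' d T q vc vu vw (Xs j))) (phi s) i \<kappa>)"
    and U: "event_U d m \<delta>' (phi 0)"
    and app: "\<forall>j<n. \<bar>flin sg d T m q (Xs j) (phi 0) (transported m d vc vu vw (phi 0))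
             - ftilde sg sg' d T q vc vu vw (Xs j)\<bar> \<le> B_app \<sigma>0 \<sigma>1 \<nu>c \<nu>u \<nu>w n m \<delta>"
  interpret attention_net \<sigma>0 \<sigma>1 \<sigma>2 \<rho>c \<rho>u \<rho>w d T m sg sg' sg'' q \<delta>' "phi 0"
    using assms H U by unfold_locales auto
  interpret attention_pgd \<sigma>0 \<sigma>1 \<sigma>2 \<rho>c \<rho>u \<rho>w d T m sg sg' sg'' q \<delta>' "phi 0" n \<tau> Xs ys phi
    "transported m d vc vu vw (phi 0)" ?K_y "B_app \<sigma>0 \<sigma>1 \<nu>c \<nu>u \<nu>w n m \<delta>"
  proof
    show "0 \<le> ?K_y" using assms by simp
    show "\<bar>ys j\<bar> \<le> ?K_y * L1 \<sigma>1 d m \<rho>u \<delta>'" if "j < n" for j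
      unfolding ys_def by (rule ftilde_le) (use assms H that in auto)
    show "transported m d vc vu vw (phi 0) \<in> Omega m d \<rho>c \<rho>u \<rho>w (phi 0)"
      by (rule transported_in_Omega[OF H(11)]) (use assms in auto)
  qed (use H pgd app in \<open>auto simp: ys_def\<close>)
  show "let L1v = L1 \<sigma>1 d m \<rho>u \<delta>'; L2v = L2 \<sigma>1 \<sigma>2 d m \<rho>u \<delta>';
         Bl = B_lin \<sigma>1 \<sigma>2 d m \<rho>c \<rho>u \<rho>w \<delta>'; Ba = B_app \<sigma>0 \<sigma>1 \<nu>c \<nu>u \<nu>w n m \<delta>;
         Lhat = loss sg d T m q n Xs (\<lambda>j. ftilde sg sg' d T q vc vu vw (Xs j))
     in (Min ((\<lambda>s. Lhat (phi s)) ` {..<\<tau>})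
           \<le> max 1 (pgd_const \<sigma>0 \<sigma>1 \<rho>c \<rho>u \<rho>w ?K_y) * (L1v^4 / sqrt (real \<tau>) + L1v * (Ba + Bl + (L1v + L2v) / sqrt (real m))))
      \<and> (Lhat (\<lambda>i \<kappa>. (1 / real \<tau>) * (\<Sum>s<\<tau>. phi s i \<kappa>))
           \<le> max 1 (pgd_const \<sigma>0 \<sigma>1 \<rho>c \<rho>u \<rho>w ?K_y) * (L1v^4 / sqrt (real \<tau>) + L1v * (Ba + Bl + (L1v + L2v) / sqrt (real m)) + Bl^2))"
    unfolding Let_def ys_def[symmetric] by (intro conjI pgd_bounds) auto
qed

end
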